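(* Let $A\in\mathbb{Z}^{m\times n}$, let $A_I:=(A\ \ I)\in\mathbb{Z}^{m\times(n+m)}$ where $I$ is the $m\times m$ identity matrix, and let $F_D$ be a $\mathrm{td}$-decomposition of $G_D(A)$. Then $$G_D(A_I)=G_D(A),\quad\text{in particular}\quad \mathrm{td}_D(A_I)=\mathrm{td}_D(A),\quad G_D(A_I)\subseteq\mathrm{cl}(F_D).$$ Let further an instance of (IP) with constraints $Ax=b$ and a $\mathrm{td}$-decomposition $F_P$ of $G_P(A)$ be given, and assume $Ax=b$ is pure. Then there is an algorithm which runs in time $O(|F_P|)$ and computes rooted trees $F_P'$, $F_P''$ with $G_P(A_I)\subseteq\mathrm{cl}(F_P')$ and $G_P(A_I)\subseteq\mathrm{cl}(F_P'')$, respectively, satisfying $$\mathrm{height}(F_P')\le\mathrm{height}(F_P)+1,\qquad \mathrm{th}(F_P')\le\mathrm{th}(F_P)+1,$$ $$\mathrm{height}(F_P'')\le2\,\mathrm{height}(F_P),\qquad \mathrm{th}(F_P'')=\mathrm{th}(F_P).$$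
   Context: (IP) is the problem $\min\{f(x)\mid Ax=b,\ l\le x\le u,\ x\in\mathbb{Z}^n\}$ with $f$ separable convex. A system $Ax=b$ is pure if the rows of $A$ are linearly independent. The primal graph $G_P(A)$ has the columns of $A$ as vertices, with two distinct columns adjacent iff some row is nonzero in both; the dual graph is $G_D(A):=G_P(A^{\top})$. The closure $\mathrm{cl}(F)$ of a rooted tree $F$ is the graph obtained from $F$ by making every vertex adjacent to all its ancestors. A $\mathrm{td}$-decomposition of a graph $G$ is a rooted tree $F$ on $V(G)$ with $G\subseteq\mathrm{cl}(F)$; $\mathrm{height}(F)$ is the maximum number of vertices on a root-leaf path, $\mathrm{td}(G)$ is the minimum height of a $\mathrm{td}$-decomposition of $G$, and $\mathrm{td}_D(A):=\mathrm{td}(G_D(A))$. A vertex of $F$ is degenerate if it has exactly one child and non-degenerate otherwise; the topological height $\mathrm{th}(F)$ is the maximum number of non-degenerate vertices on a root-leaf path. $|F_P|$ is the size of $F_P$. As throughout the paper, $G_P(A)$ and $G_D(A)$ are assumed connected.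
   Formalization: The English fixes no input format; here the nonzeros of each row of A are given as a list ordered along F_P from the lowest column towards the root, since with rows in arbitrary order (or A as a dense array) time O(|F_P|), with |F_P| the number of vertices, is impossible. *)

theory Defs
  imports
    "HOL-Analysis.Convex"
    "HOL-Library.Extended"
    "Graph_Theory.Digraph_Component"
    "Jordan_Normal_Form.VS_Connect"
begin

section \<open>Integer programs and pure systems\<close>

text \<open>An instance of \<open>min {f x | A x = b, l \<le> x \<le> u, x integral}\<close>; bounds may be infinite.\<close>

record ip =
  ip_A :: "int mat"
  ip_b :: "int vec"
  ip_l :: "int extended vec"
  ip_u :: "int extended vec"
  ip_f :: "real vec \<Rightarrow> real"

definition separable_convex :: "nat \<Rightarrow> (real vec \<Rightarrow> real) \<Rightarrow> bool" where
  "separable_convex n f \<longleftrightarrow>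
     (\<exists>g :: nat \<Rightarrow> real \<Rightarrow> real. (\<forall>i<n. convex_on UNIV (g i)) \<and>
        (\<forall>x \<in> carrier_vec n. f x = (\<Sum>i<n. g i (vec_index x i))))"

definition ip_instance :: "ip \<Rightarrow> bool" where
  "ip_instance P \<longleftrightarrow>
     ip_b P \<in> carrier_vec (dim_row (ip_A P)) \<and>
     ip_l P \<in> carrier_vec (dim_col (ip_A P)) \<and>
     ip_u P \<in> carrier_vec (dim_col (ip_A P)) \<and>
     separable_convex (dim_col (ip_A P)) (ip_f P)"

text \<open>Linear independence of the rows as a family, hence the distinctness requirement.\<close>

definition pure :: "int mat \<Rightarrow> bool" where
  "pure A \<longleftrightarrow>
     (let R = rows (map_mat rat_of_int A)
      in distinct R \<and>
         LinearCombinations.module.lin_indpt class_ring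
           (module_vec TYPE(rat) (dim_col A)) (set R))"

definition with_identity :: "int mat \<Rightarrow> int mat" where
  "with_identity A =
     four_block_mat A (1\<^sub>m (dim_row A)) (0\<^sub>m 0 (dim_col A)) (0\<^sub>m 0 (dim_row A))"


section \<open>Primal and dual graphs\<close>

text \<open>Simple graphs are loop-free symmetric digraphs without parallel arcs.\<close>

definition primal_graph :: "int mat \<Rightarrow> nat pair_pre_digraph" where
  "primal_graph A =
     \<lparr> pverts = {..<dim_col A},
       parcs = {(j, k). j < dim_col A \<and> k < dim_col A \<and> j \<noteq> k \<and>
                  (\<exists>i<dim_row A. A $$ (i, j) \<noteq> 0 \<and> A $$ (i, k) \<noteq> 0)} \<rparr>"

definition dual_graph :: "int mat \<Rightarrow> nat pair_pre_digraph" where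
  "dual_graph A = primal_graph (transpose_mat A)"


section \<open>Rooted trees and tree-depth\<close>

text \<open>
  A rooted tree is given by its parent function. By convention the root is its own parent;
  the function is irrelevant outside the vertex set.
\<close>

record 'a rtree =
  tverts :: "'a set"
  troot :: 'a
  tparent :: "'a \<Rightarrow> 'a"

definition rooted_tree :: "'a rtree \<Rightarrow> bool" where
  "rooted_tree F \<longleftrightarrow>
     finite (tverts F) \<and> troot F \<in> tverts F \<and> tparent F (troot F) = troot F \<and>
     (\<forall>v \<in> tverts F. tparent F v \<in> tverts F) \<and>
     (\<forall>v \<in> tverts F. \<exists>k. (tparent F ^^ k) v = troot F)"

definition root_path :: "'a rtree \<Rightarrow> 'a \<Rightarrow> 'a set" where
  "root_path F v = {(tparent F ^^ k) v | k. True}"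

definition ancestors :: "'a rtree \<Rightarrow> 'a \<Rightarrow> 'a set" where
  "ancestors F v = root_path F v - {v}"

definition children :: "'a rtree \<Rightarrow> 'a \<Rightarrow> 'a set" where
  "children F v = {u \<in> tverts F. u \<noteq> troot F \<and> tparent F u = v}"

definition leaves :: "'a rtree \<Rightarrow> 'a set" where
  "leaves F = {v \<in> tverts F. children F v = {}}"

definition degenerate :: "'a rtree \<Rightarrow> 'a \<Rightarrow> bool" where
  "degenerate F v \<longleftrightarrow> card (children F v) = 1"

definition height :: "'a rtree \<Rightarrow> nat" where
  "height F = Max ((\<lambda>v. card (root_path F v)) ` leaves F)"

definition topological_height :: "'a rtree \<Rightarrow> nat" where
  "topological_height F =
     Max ((\<lambda>v. card {u \<in> root_path F v. \<not> degenerate F u}) ` leaves F)"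

definition cl :: "'a rtree \<Rightarrow> 'a pair_pre_digraph" where
  "cl F =
     \<lparr> pverts = tverts F,
       parcs = {(u, v). u \<in> tverts F \<and> v \<in> tverts F \<and>
                  (u \<in> ancestors F v \<or> v \<in> ancestors F u)} \<rparr>"

definition td_decomposition :: "'a pair_pre_digraph \<Rightarrow> 'a rtree \<Rightarrow> bool" where
  "td_decomposition G F \<longleftrightarrow>
     rooted_tree F \<and> tverts F = pverts G \<and> subgraph (with_proj G) (with_proj (cl F))"

definition td :: "'a pair_pre_digraph \<Rightarrow> nat" where
  "td G = Inf {height F | F. td_decomposition G F}"

definition td_D :: "int mat \<Rightarrow> nat" where
  "td_D A = td (dual_graph A)"


section \<open>Random access machine programs and their running time\<close>

text \<open>
  Programs work on integer variables and integer arrays, with indirect addressing. As in the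
  unit-cost random access machine of Cook and Reckhow, the operations are constants, loads,
  stores, addition, subtraction and tests for positivity, and each of them takes one step.
  There is deliberately no unit-cost multiplication. A program is a fixed finite object,
  so it mentions only finitely many variables and arrays.
\<close>

record store =
  var :: "string \<Rightarrow> int"
  arr :: "string \<Rightarrow> int \<Rightarrow> int"

datatype exp =
    Num int
  | Var string
  | Elem string exp
  | Plus exp exp
  | Minus exp exp

primrec aval :: "store \<Rightarrow> exp \<Rightarrow> int" where
  "aval s (Num k) = k"
| "aval s (Var x) = var s x"
| "aval s (Elem a e) = arr s a (aval s e)"
| "aval s (Plus e1 e2) = aval s e1 + aval s e2"
| "aval s (Minus e1 e2) = aval s e1 - aval s e2"

primrec cost :: "exp \<Rightarrow> nat" where
  "cost (Num k) = 1"
| "cost (Var x) = 1"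
| "cost (Elem a e) = 1 + cost e"
| "cost (Plus e1 e2) = 1 + cost e1 + cost e2"
| "cost (Minus e1 e2) = 1 + cost e1 + cost e2"

datatype com =
    Skip
  | Assign string exp
  | AssignElem string exp exp
  | Seq com com
  | IfPos exp com com
  | WhilePos exp com

text \<open>\<open>exec c s t s'\<close>: started in \<open>s\<close>, the program \<open>c\<close> halts after \<open>t\<close> steps in \<open>s'\<close>.\<close>

inductive exec :: "com \<Rightarrow> store \<Rightarrow> nat \<Rightarrow> store \<Rightarrow> bool" where
  Skip: "exec Skip s 1 s"
| Assign: "exec (Assign x e) s (1 + cost e) (s\<lparr>var := (var s)(x := aval s e)\<rparr>)"
| AssignElem: "exec (AssignElem a i e) s (1 + cost i + cost e)
    (s\<lparr>arr := (arr s)(a := (arr s a)(aval s i := aval s e))\<rparr>)"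
| Seq: "exec c1 s t1 s' \<Longrightarrow> exec c2 s' t2 s'' \<Longrightarrow> exec (Seq c1 c2) s (t1 + t2) s''"
| IfTrue: "aval s e > 0 \<Longrightarrow> exec c1 s t s' \<Longrightarrow> exec (IfPos e c1 c2) s (1 + cost e + t) s'"
| IfFalse: "\<not> aval s e > 0 \<Longrightarrow> exec c2 s t s' \<Longrightarrow> exec (IfPos e c1 c2) s (1 + cost e + t) s'"
| WhileFalse: "\<not> aval s e > 0 \<Longrightarrow> exec (WhilePos e c) s (1 + cost e) s"
| WhileTrue: "aval s e > 0 \<Longrightarrow> exec c s t1 s' \<Longrightarrow> exec (WhilePos e c) s' t2 s'' \<Longrightarrow>
    exec (WhilePos e c) s (1 + cost e + t1 + t2) s''"


section \<open>Input and output format\<close>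

text \<open>A tree on the vertices \<open>0, \<dots>, N - 1\<close> is stored as a parent array.\<close>

definition stores_tree :: "store \<Rightarrow> string \<Rightarrow> nat \<Rightarrow> nat rtree \<Rightarrow> bool" where
  "stores_tree s a N F \<longleftrightarrow>
     tverts F = {..<N} \<and> (\<forall>v<N. arr s a (int v) = int (tparent F v))"

text \<open>
  The matrix is stored in compressed sparse row format: the nonzero entries of row \<open>i\<close>
  occupy the positions from \<open>rowptr i\<close> up to but excluding \<open>rowptr (i + 1)\<close> of the arrays of
  column indices and values. The columns in which a row is nonzero form a clique of the primal
  graph, so they lie on one root-leaf path of a td-decomposition; each row is listed along this
  path in the direction of the root. With the entries of a row in arbitrary order, just
  finding the lowest of these columns, for all rows, takes more than \<open>O(|F|)\<close> steps in general,
  as the number of nonzero entries is not bounded linearly in \<open>|F|\<close>.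
\<close>

definition upward_support :: "nat rtree \<Rightarrow> int mat \<Rightarrow> nat \<Rightarrow> nat list \<Rightarrow> bool" where
  "upward_support F A i js \<longleftrightarrow>
     set js = {j. j < dim_col A \<and> A $$ (i, j) \<noteq> 0} \<and>
     sorted_wrt (\<lambda>u v. v \<in> ancestors F u) js"

definition stores_matrix :: "store \<Rightarrow> nat rtree \<Rightarrow> int mat \<Rightarrow> bool" where
  "stores_matrix s F A \<longleftrightarrow>
     var s ''rows'' = int (dim_row A) \<and> var s ''columns'' = int (dim_col A) \<and>
     arr s ''rowptr'' 0 = 0 \<and>
     (\<forall>i<dim_row A. \<exists>js. upward_support F A i js \<and>
        arr s ''rowptr'' (int i + 1) = arr s ''rowptr'' (int i) + int (length js) \<and>
        (\<forall>k<length js.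
           arr s ''colind'' (arr s ''rowptr'' (int i) + int k) = int (js ! k) \<and>
           arr s ''values'' (arr s ''rowptr'' (int i) + int k) = A $$ (i, js ! k)))"

text \<open>
  All parts of the initial store that are not mentioned here are arbitrary: they may hold the
  remaining data of an instance, and the program cannot rely on initialised memory.
\<close>

definition stores_input :: "store \<Rightarrow> ip \<Rightarrow> nat rtree \<Rightarrow> bool" where
  "stores_input s P F \<longleftrightarrow>
     stores_matrix s F (ip_A P) \<and> stores_tree s ''parent'' (dim_col (ip_A P)) F"

end

theory Submission
  imports Defs
begin

text \<open>
  The nonzero columns of a row form a clique of the primal graph and hence lie on one root path;
  let \<open>low i\<close> be the lowest of them for row \<open>i\<close>. In \<open>A\<^sub>I\<close>, the new column of row \<open>i\<close> is adjacent
  only to these columns. For the first tree, hang the new vertex below some leaf under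
  \<open>low i\<close>: root paths grow by one vertex, and inner vertices keep their children. For the second
  tree, insert it on the edge from \<open>low i\<close> to its parent: the inserted vertices are degenerate and
  no other vertex changes its number of children. Rows with \<open>low i\<close> on a given root path have their
  support on this path, so by linear independence there are at most as many of them as the path
  has vertices, and the height at most doubles.
\<close>

section \<open>Rooted trees\<close>

text \<open>Hanging the new vertex directly below \<open>low i\<close> would respect the height
  bound but not the topological one: a degenerate vertex that receives a second child becomes
  non-degenerate, and this can happen all along one path. A leaf has no children and is already
  non-degenerate, so new children below it do no harm. When edges are subdivided, many rows may
  share the same \<open>low i\<close> and pile up on one edge; the shape of the tree does not limit
  them, only the rank argument does. Purity enters in two more places: it excludes zero rows, which
  have no lowest column, and it gives at most as many rows as columns, so that time linear in
  \<open>n + m\<close> is linear in the size of the tree. To reach linear time, neither lowest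
  columns nor leaves may be searched for row by row: the lowest column is the first entry of the
  stored row, and one sweep labels every vertex with a leaf below it.\<close>

lemma root_path_parent:
  "root_path F v = insert v (root_path F (tparent F v))"
proof -
  have "(tparent F ^^ k) v \<in> insert v {(tparent F ^^ j) (tparent F v) | j. True}" for k
    by (cases k) (auto simp: funpow_swap1)
  moreover have "(tparent F ^^ j) (tparent F v) = (tparent F ^^ Suc j) v" for j
    by (simp add: funpow_swap1)
  moreover have "v = (tparent F ^^ 0) v" by simp
  ultimately show ?thesis unfolding root_path_def by blast
qed

lemma self_in_root_path [simp]: "v \<in> root_path F v"
  by (subst root_path_parent) simp

lemma root_path_trans:
  assumes "u \<in> root_path F v" shows "root_path F u \<subseteq> root_path F v"
proof -
  from assms obtain j where "u = (tparent F ^^ j) v" by (auto simp: root_path_def)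
  then have "(tparent F ^^ k) u = (tparent F ^^ (k + j)) v" for k by (simp add: funpow_add)
  then show ?thesis unfolding root_path_def by blast
qed

text \<open>Induction on the number of parent steps. Closure is demanded only at points of the path
  itself, which allows comparing the paths of two trees whose parent functions agree only
  there.\<close>

lemma root_path_least:
  assumes "v \<in> S" "\<And>x. x \<in> S \<Longrightarrow> x \<in> root_path F v \<Longrightarrow> tparent F x \<in> S"
  shows "root_path F v \<subseteq> S"
proof -
  have "(tparent F ^^ k) v \<in> S" for k
  proof (induction k)
    case (Suc k)
    then show ?case using assms(2)[of "(tparent F ^^ k) v"] by (auto simp: root_path_def)
  qed (simp add: assms)
  then show ?thesis by (auto simp: root_path_def)
qed

lemma root_path_step: "x \<in> root_path F v \<Longrightarrow> tparent F x \<in> root_path F v"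
  using root_path_trans[of x F v] root_path_parent[of F x] by auto

lemma root_path_subset: "rooted_tree F \<Longrightarrow> v \<in> tverts F \<Longrightarrow> root_path F v \<subseteq> tverts F"
  by (rule root_path_least) (auto simp: rooted_tree_def)

lemma finite_root_path: "rooted_tree F \<Longrightarrow> v \<in> tverts F \<Longrightarrow> finite (root_path F v)"
  using root_path_subset[of F v] finite_subset by (auto simp: rooted_tree_def)

lemma root_path_fixpoint: "tparent F v = v \<Longrightarrow> root_path F v = {v}"
  using root_path_least[of v "{v}" F] by auto

lemma root_path_troot: "rooted_tree F \<Longrightarrow> root_path F (troot F) = {troot F}"
  by (simp add: root_path_fixpoint rooted_tree_def)

lemma troot_in_root_path: "rooted_tree F \<Longrightarrow> v \<in> tverts F \<Longrightarrow> troot F \<in> root_path F v"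
  unfolding rooted_tree_def root_path_def by (metis (mono_tags, lifting) mem_Collect_eq)

lemma rooted_treeI:
  assumes "finite (tverts F)" "troot F \<in> tverts F" "tparent F (troot F) = troot F"
    "\<And>v. v \<in> tverts F \<Longrightarrow> tparent F v \<in> tverts F"
    "\<And>v. v \<in> tverts F \<Longrightarrow> troot F \<in> root_path F v"
  shows "rooted_tree F"
proof -
  have "\<exists>k. (tparent F ^^ k) v = troot F" if "v \<in> tverts F" for v
    using assms(5)[OF that] by (auto simp: root_path_def)
  then show ?thesis using assms by (simp add: rooted_tree_def)
qed

text \<open>Induction on the number of parent steps to the root.\<close>

lemma rooted_tree_induct [consumes 2, case_names root step]:
  assumes F: "rooted_tree F" "v \<in> tverts F"
    and "P (troot F)"
    and "\<And>u. u \<in> tverts F \<Longrightarrow> u \<noteq> troot F \<Longrightarrow> P (tparent F u) \<Longrightarrow> P u"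
  shows "P v"
proof -
  obtain k where "(tparent F ^^ k) v = troot F" using F by (auto simp: rooted_tree_def)
  then show ?thesis using F(2)
  proof (induction k arbitrary: v)
    case (Suc k)
    show ?case
    proof (cases "v = troot F")
      case False
      have "P (tparent F v)"
        using Suc F(1) by (intro Suc.IH) (auto simp: funpow_swap1 rooted_tree_def)
      then show ?thesis using assms(4) Suc.prems False by blast
    qed (simp add: assms)
  qed (use assms in simp)
qed

text \<open>A return to \<open>u\<close> after \<open>Suc j\<close> steps would make
  \<open>u\<close> periodic. If the root is reached after \<open>k\<close> steps, then
  \<open>k\<close> periods lead at least that far, and the root is a fixed point, so
  \<open>u\<close> would be the root.\<close>

lemma not_in_root_path_parent:
  assumes F: "rooted_tree F" "u \<in> tverts F" "u \<noteq> troot F"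
  shows "u \<notin> root_path F (tparent F u)"
proof
  assume "u \<in> root_path F (tparent F u)"
  then obtain j where j: "u = (tparent F ^^ j) (tparent F u)" by (auto simp: root_path_def)
  have per: "((tparent F ^^ Suc j) ^^ k) u = u" for k
    using j by (induction k) (auto simp: funpow_swap1)
  obtain k where k: "(tparent F ^^ k) u = troot F" using F by (auto simp: rooted_tree_def)
  have fixed: "(tparent F ^^ i) (troot F) = troot F" for i
    using F(1) by (induction i) (auto simp: rooted_tree_def)
  have "u = (tparent F ^^ (Suc j * k)) u" using per[of k] by (simp only: funpow_mult)
  also have "\<dots> = (tparent F ^^ (j * k + k)) u" by (simp add: algebra_simps)
  also have "\<dots> = troot F" by (simp only: funpow_add o_apply k fixed)
  finally show False using F by simp
qed

lemma parent_neq: "rooted_tree F \<Longrightarrow> u \<in> tverts F \<Longrightarrow> tparent F u = u \<longleftrightarrow> u = troot F"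
  by (metis not_in_root_path_parent rooted_tree_def self_in_root_path)

text \<open>Among the vertices whose root path contains \<open>v\<close>, one with the longest root
  path is a leaf: a child of it would also lie below \<open>v\<close> and be deeper.\<close>

lemma exists_leaf_below:
  assumes F: "rooted_tree F" "v \<in> tverts F"
  shows "\<exists>w \<in> leaves F. v \<in> root_path F w"
proof -
  let ?D = "{w \<in> tverts F. v \<in> root_path F w}"
  have "finite ?D" "v \<in> ?D" using F by (auto simp: rooted_tree_def)
  then have "Max ((\<lambda>w. card (root_path F w)) ` ?D) \<in> (\<lambda>w. card (root_path F w)) ` ?D"
    by (intro Max_in) auto
  then obtain w where w: "w \<in> ?D"
    and "card (root_path F w) = Max ((\<lambda>w. card (root_path F w)) ` ?D)" by auto
  then have max: "card (root_path F x) \<le> card (root_path F w)" if "x \<in> ?D" for x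
    using that \<open>finite ?D\<close> by simp
  have "children F w = {}"
  proof (rule ccontr)
    assume "children F w \<noteq> {}"
    then obtain x where x: "x \<in> tverts F" "x \<noteq> troot F" "tparent F x = w"
      by (auto simp: children_def)
    have rp: "root_path F x = insert x (root_path F w)" using root_path_parent[of F x] x by simp
    have "x \<notin> root_path F w" using not_in_root_path_parent[OF F(1) x(1,2)] x by simp
    then have "card (root_path F x) = Suc (card (root_path F w))"
      using rp finite_root_path[OF F(1)] w by simp
    moreover have "x \<in> ?D" using rp w x by auto
    ultimately show False using max[of x] by simp
  qed
  then show ?thesis using w by (auto simp: leaves_def)
qed

lemma finite_leaves: "rooted_tree F \<Longrightarrow> finite (leaves F)"
  by (auto simp: leaves_def rooted_tree_def)

lemma leaves_nonempty: "rooted_tree F \<Longrightarrow> leaves F \<noteq> {}"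
  using exists_leaf_below[of F "troot F"] by (auto simp: rooted_tree_def)

lemma finite_children: "rooted_tree F \<Longrightarrow> finite (children F v)"
  by (auto simp: children_def rooted_tree_def)

lemma height_le_iff:
  "rooted_tree F \<Longrightarrow> height F \<le> h \<longleftrightarrow> (\<forall>w \<in> leaves F. card (root_path F w) \<le> h)"
  by (simp add: height_def finite_leaves leaves_nonempty)

lemma topological_height_le_iff:
  "rooted_tree F \<Longrightarrow> topological_height F \<le> h \<longleftrightarrow>
    (\<forall>w \<in> leaves F. card {u \<in> root_path F w. \<not> degenerate F u} \<le> h)"
  by (simp add: topological_height_def finite_leaves leaves_nonempty)

text \<open>Well-formedness and compatibility, which \<open>subgraph\<close> also demands, are
  automatic for pair digraphs, so only comparability of the ends of each arc remains. Loop-freeness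
  of \<open>G\<close> allows \<open>root_path\<close> in place of \<open>ancestors\<close>.\<close>

lemma subgraph_cl_iff:
  assumes "pverts G = tverts F" "rooted_tree F"
    "\<And>u v. (u, v) \<in> parcs G \<Longrightarrow> u \<in> pverts G \<and> v \<in> pverts G \<and> u \<noteq> v"
  shows "subgraph (with_proj G) (with_proj (cl F)) \<longleftrightarrow>
    (\<forall>(u, v) \<in> parcs G. u \<in> root_path F v \<or> v \<in> root_path F u)"
proof -
  have wf: "wf_digraph (with_proj (cl F))"
    by unfold_locales (auto simp: cl_def)
  have wf': "wf_digraph (with_proj G)"
    using assms(3)[of "fst e" "snd e" for e] by unfold_locales auto
  show ?thesis
    unfolding subgraph_def using wf wf' assms
    by (fastforce simp: compatible_def cl_def ancestors_def)
qed

section \<open>Grafting leaves and subdividing edges\<close>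

definition graft :: "'a rtree \<Rightarrow> 'a set \<Rightarrow> ('a \<Rightarrow> 'a) \<Rightarrow> 'a rtree" where
  "graft F X g = \<lparr>tverts = tverts F \<union> X, troot = troot F,
     tparent = (\<lambda>v. if v \<in> X then g v else tparent F v)\<rparr>"

lemma graft_simps [simp]:
  "tverts (graft F X g) = tverts F \<union> X" "troot (graft F X g) = troot F"
  "tparent (graft F X g) v = (if v \<in> X then g v else tparent F v)"
  by (auto simp: graft_def)

context
  fixes F :: "'a rtree" and X g
  assumes F: "rooted_tree F" and X: "finite X" "X \<inter> tverts F = {}"
    and g: "\<And>x. x \<in> X \<Longrightarrow> g x \<in> leaves F"
begin

lemma root_path_graft_old:
  assumes "v \<in> tverts F" shows "root_path (graft F X g) v = root_path F v"
proof
  note sub = root_path_subset[OF F assms]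
  show "root_path (graft F X g) v \<subseteq> root_path F v"
  proof (rule root_path_least)
    fix x assume x: "x \<in> root_path F v"
    then show "tparent (graft F X g) x \<in> root_path F v"
      using root_path_step[OF x] sub X by auto
  qed simp
  show "root_path F v \<subseteq> root_path (graft F X g) v"
  proof (rule root_path_least)
    fix x assume x: "x \<in> root_path (graft F X g) v" "x \<in> root_path F v"
    then show "tparent F x \<in> root_path (graft F X g) v"
      using root_path_step[OF x(1)] sub X by (auto split: if_splits)
  qed simp
qed

lemma root_path_graft_new:
  assumes "x \<in> X" shows "root_path (graft F X g) x = insert x (root_path F (g x))"
  using assms g[OF assms] root_path_parent[of "graft F X g" x]
  by (simp add: root_path_graft_old leaves_def)

lemma rooted_tree_graft: "rooted_tree (graft F X g)"
proof (rule rooted_treeI)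
  fix v assume v: "v \<in> tverts (graft F X g)"
  show "tparent (graft F X g) v \<in> tverts (graft F X g)"
    using v F g by (auto simp: rooted_tree_def leaves_def)
  show "troot (graft F X g) \<in> root_path (graft F X g) v"
    using v g troot_in_root_path[OF F]
    by (auto simp: root_path_graft_old root_path_graft_new leaves_def)
qed (use F X in \<open>auto simp: rooted_tree_def\<close>)

lemma children_graft_old:
  assumes "v \<in> tverts F" "v \<notin> leaves F"
  shows "children (graft F X g) v = children F v"
  using assms F X g by (auto simp: children_def rooted_tree_def)

lemma leaves_graft: "leaves (graft F X g) \<subseteq> leaves F \<union> X"
  using children_graft_old by (auto simp: leaves_def)

lemma height_graft: "height (graft F X g) \<le> height F + 1"
proof -
  have h: "card (root_path F w) \<le> height F" if "w \<in> leaves F" for w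
    using height_le_iff[OF F] that by blast
  have "card (root_path (graft F X g) w) \<le> height F + 1" if w: "w \<in> leaves F \<union> X" for w
  proof (cases "w \<in> X")
    case True
    have "card (insert w (root_path F (g w))) \<le> Suc (card (root_path F (g w)))"
      by (simp add: card_insert_le_m1 card_insert_if finite_root_path[OF F] g[OF True, unfolded leaves_def, simplified])
    then show ?thesis using True h[OF g[OF True]] by (simp add: root_path_graft_new)
  next
    case False
    then show ?thesis using w h[of w] by (simp add: root_path_graft_old leaves_def)
  qed
  then show ?thesis using leaves_graft by (subst height_le_iff[OF rooted_tree_graft]) blast
qed

text \<open>An inner vertex keeps its children, and a leaf of \<open>F\<close> is non-degenerate
  from the start. A leaf that receives exactly one new vertex turns degenerate, hence only one
  implication.\<close>

lemma nondegenerate_graft: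
  assumes "v \<in> tverts F" "\<not> degenerate (graft F X g) v" shows "\<not> degenerate F v"
  using assms children_graft_old[of v] by (cases "v \<in> leaves F") (auto simp: degenerate_def leaves_def)

lemma topological_height_graft:
  "topological_height (graft F X g) \<le> topological_height F + 1"
proof -
  let ?N = "\<lambda>F w. {u \<in> root_path F w. \<not> degenerate F u}"
  have h: "card (?N F w) \<le> topological_height F" if "w \<in> leaves F" for w
    using topological_height_le_iff[OF F] that by blast
  have "card (?N (graft F X g) w) \<le> topological_height F + 1" if w: "w \<in> leaves F \<union> X" for w
  proof (cases "w \<in> X")
    case True
    have l: "g w \<in> leaves F" "g w \<in> tverts F" using g[OF True] by (auto simp: leaves_def)
    have "?N (graft F X g) w \<subseteq> insert w (?N F (g w))"
      using True root_path_subset[OF F l(2)] nondegenerate_graft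
      by (auto simp: root_path_graft_new)
    then have "card (?N (graft F X g) w) \<le> card (insert w (?N F (g w)))"
      using finite_root_path[OF F l(2)] by (intro card_mono) auto
    also have "\<dots> \<le> Suc (card (?N F (g w)))"
      using finite_root_path[OF F l(2)] by (simp add: card_insert_if)
    finally show ?thesis using h[OF l(1)] by simp
  next
    case False
    then have l: "w \<in> leaves F" "w \<in> tverts F" using w by (auto simp: leaves_def)
    have "?N (graft F X g) w \<subseteq> ?N F w"
      using l root_path_subset[OF F l(2)] nondegenerate_graft
      by (auto simp: root_path_graft_old)
    then have "card (?N (graft F X g) w) \<le> card (?N F w)"
      using finite_root_path[OF F l(2)] by (intro card_mono) auto
    then show ?thesis using h[OF l(1)] by simp
  qed
  then show ?thesis
    using leaves_graft by (subst topological_height_le_iff[OF rooted_tree_graft]) blast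
qed

end

text \<open>Above the root there is no edge to subdivide. There \<open>x\<close> becomes the new
  root and its own parent; copying the parent of \<open>v\<close>, which is \<open>v\<close> itself,
  would create a cycle.\<close>

definition insert_above :: "'a rtree \<Rightarrow> 'a \<Rightarrow> 'a \<Rightarrow> 'a rtree" where
  "insert_above F v x = \<lparr>tverts = insert x (tverts F),
     troot = (if v = troot F then x else troot F),
     tparent = (tparent F)(x := if v = troot F then x else tparent F v, v := x)\<rparr>"

lemma insert_above_simps [simp]:
  "tverts (insert_above F v x) = insert x (tverts F)"
  "troot (insert_above F v x) = (if v = troot F then x else troot F)"
  "tparent (insert_above F v x) u =
    (if u = v then x else if u = x then if v = troot F then x else tparent F v else tparent F u)"
  by (auto simp: insert_above_def)

context
  fixes F :: "'a rtree" and v x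
  assumes F: "rooted_tree F" and v: "v \<in> tverts F" and x: "x \<notin> tverts F"
begin

lemma subdivision_vertex_neq: "x \<noteq> v" "v \<noteq> x"
  using v x by auto

lemma root_path_insert_above_old:
  assumes "u \<in> tverts F"
  shows "root_path (insert_above F v x) u =
    root_path F u \<union> (if v \<in> root_path F u then {x} else {})"
  using F assms
proof (induction rule: rooted_tree_induct)
  case root
  note r = F[unfolded rooted_tree_def]
  show ?case
  proof (cases "v = troot F")
    case True
    have "root_path (insert_above F v x) x = {x}"
      using True by (intro root_path_fixpoint) simp
    then show ?thesis
      using True root_path_parent[of "insert_above F v x" v] root_path_troot[OF F] by auto
  next
    case False
    then have "root_path (insert_above F v x) (troot F) = {troot F}"
      using r x by (intro root_path_fixpoint) auto
    then show ?thesis using False root_path_troot[OF F] by auto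
  qed
next
  case (step u)
  have p: "tparent F u \<in> tverts F" using step F by (auto simp: rooted_tree_def)
  show ?case
  proof (cases "u = v")
    case True
    \<comment> \<open>By acyclicity, the induction hypothesis for the parent of \<open>v\<close>
      does not contribute \<open>x\<close>.\<close>
    have "v \<notin> root_path F (tparent F v)" using not_in_root_path_parent[OF F] step True by blast
    then have "root_path (insert_above F v x) (tparent F v) = root_path F (tparent F v)"
      using step True by simp
    then have "root_path (insert_above F v x) x = insert x (root_path F (tparent F v))"
      using step True subdivision_vertex_neq by (subst root_path_parent) simp
    moreover have "root_path (insert_above F v x) v = insert v (root_path (insert_above F v x) x)"
      by (subst root_path_parent) simp
    moreover have "root_path F v = insert v (root_path F (tparent F v))"
      by (rule root_path_parent)
    ultimately show ?thesis using True by auto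
  next
    case False
    moreover have "u \<noteq> x" using step x by auto
    ultimately have "root_path (insert_above F v x) u =
        insert u (root_path (insert_above F v x) (tparent F u))"
      by (subst root_path_parent) simp
    moreover have "root_path F u = insert u (root_path F (tparent F u))"
      by (rule root_path_parent)
    ultimately show ?thesis using False step(3) by auto
  qed
qed

text \<open>The new vertex takes the place of \<open>v\<close> below the old proper ancestors of
  \<open>v\<close>.\<close>

lemma root_path_insert_above_new:
  "root_path (insert_above F v x) x = insert x (root_path F v - {v})"
proof (cases "v = troot F")
  case True
  have "root_path (insert_above F v x) x = {x}"
    using True by (intro root_path_fixpoint) simp
  then show ?thesis using True root_path_troot[OF F] by auto
next
  case False
  have p: "tparent F v \<in> tverts F" using v F by (auto simp: rooted_tree_def)
  have "v \<notin> root_path F (tparent F v)" using not_in_root_path_parent[OF F] v False by blast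
  moreover have "root_path (insert_above F v x) x =
      insert x (root_path (insert_above F v x) (tparent F v))"
    using False subdivision_vertex_neq by (subst root_path_parent) simp
  moreover have "root_path F v = insert v (root_path F (tparent F v))"
    by (rule root_path_parent)
  ultimately show ?thesis using root_path_insert_above_old[OF p] by auto
qed

lemma rooted_tree_insert_above: "rooted_tree (insert_above F v x)"
proof (rule rooted_treeI)
  fix u assume u: "u \<in> tverts (insert_above F v x)"
  show "tparent (insert_above F v x) u \<in> tverts (insert_above F v x)"
    using u F v x by (cases "u = v"; cases "u = x") (auto simp: rooted_tree_def)
  show "troot (insert_above F v x) \<in> root_path (insert_above F v x) u"
    using u troot_in_root_path[OF F] v
    by (cases "u = x") (auto simp: root_path_insert_above_old root_path_insert_above_new)
qed (use F v x in \<open>auto simp: rooted_tree_def\<close>)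

lemma children_insert_above_new: "children (insert_above F v x) x = {v}"
proof -
  have "tparent F u \<noteq> x" if "u \<in> tverts F" for u using F x that by (auto simp: rooted_tree_def)
  then show ?thesis using v x by (auto simp: children_def split: if_splits)
qed

lemma children_insert_above_old:
  assumes "u \<in> tverts F"
  shows "children (insert_above F v x) u = (if v \<in> children F u then insert x (children F u - {v}) else children F u)"
proof -
  have ux: "u \<noteq> x" using assms x by auto
  have "y \<in> children (insert_above F v x) u \<longleftrightarrow>
    y \<in> (if v \<in> children F u then insert x (children F u - {v}) else children F u)" for y
    using F v x ux assms
    by (cases "y = x"; cases "y = v"; cases "y \<in> tverts F") (auto simp: children_def rooted_tree_def)
  then show ?thesis by blast
qed

text \<open>In the child set of the old parent of \<open>v\<close>, \<open>x\<close> replaces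
  \<open>v\<close>; this exchange is why degeneracy is preserved.\<close>

lemma card_children_insert_above_old:
  assumes "u \<in> tverts F"
  shows "card (children (insert_above F v x) u) = card (children F u)"
proof -
  have "x \<notin> children F u" using x by (auto simp: children_def)
  then show ?thesis
    using card_Suc_Diff1[OF finite_children[OF F]] finite_children[OF F]
    by (auto simp: children_insert_above_old[OF assms])
qed

lemma leaves_insert_above: "leaves (insert_above F v x) = leaves F"
proof -
  have "children (insert_above F v x) u = {} \<longleftrightarrow> children F u = {}" if "u \<in> tverts F" for u
    using children_insert_above_old[OF that] by (auto split: if_splits)
  then show ?thesis using children_insert_above_new x by (auto simp: leaves_def)
qed

lemma degenerate_insert_above:
  "u \<in> tverts F \<Longrightarrow> degenerate (insert_above F v x) u \<longleftrightarrow> degenerate F u"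
  "degenerate (insert_above F v x) x"
  by (simp_all add: degenerate_def card_children_insert_above_old children_insert_above_new)

end

section \<open>Rows of a pure system\<close>

text \<open>Gaussian elimination, one equation at a time: \<open>J\<close> indexes the unknowns and
  \<open>S\<close> the equations. A pivot unknown \<open>p\<close> with nonzero coefficient in
  equation \<open>s\<close> is eliminated from the other equations, which are then solved over
  \<open>J - {p}\<close>.\<close>

lemma underdetermined_homogeneous_system:
  fixes a :: "'i \<Rightarrow> 'j \<Rightarrow> 'a :: field"
  assumes "finite S" "finite J" "card S < card J"
  shows "\<exists>c. (\<exists>i\<in>J. c i \<noteq> 0) \<and> (\<forall>j\<in>S. (\<Sum>i\<in>J. c i * a i j) = 0)"
  using assms
proof (induction S arbitrary: J a rule: finite_induct)
  case empty
  then obtain i where "i \<in> J" by fastforce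
  then show ?case by (intro exI[of _ "\<lambda>_. 1"]) auto
next
  case (insert s S)
  show ?case
  proof (cases "\<forall>i\<in>J. a i s = 0")
    case True
    then show ?thesis using insert.IH[of J a] insert.prems insert.hyps by auto
  next
    case False
    then obtain p where p: "p \<in> J" "a p s \<noteq> 0" by blast
    define J' where "J' = J - {p}"
    have J: "J = insert p J'" "p \<notin> J'" "finite J'" using p insert.prems by (auto simp: J'_def)
    have "card S < card J'" using insert J by simp
    from insert.IH[OF J(3) this, of "\<lambda>i j. a i j - a i s / a p s * a p j"] obtain c where
      c: "\<exists>i\<in>J'. c i \<noteq> 0" "\<And>j. j \<in> S \<Longrightarrow> (\<Sum>i\<in>J'. c i * (a i j - a i s / a p s * a p j)) = 0"
      by blast
    \<comment> \<open>Back substitution: equation \<open>s\<close> forces the value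
      \<open>- t\<close> of the unknown \<open>p\<close>.\<close>
    define t where "t = (\<Sum>i\<in>J'. c i * a i s) / a p s"
    define d where "d = c(p := - t)"
    have sum_d: "(\<Sum>i\<in>J. d i * a i j) = (\<Sum>i\<in>J'. c i * a i j) - t * a p j" for j
    proof -
      have "(\<Sum>i\<in>J'. d i * a i j) = (\<Sum>i\<in>J'. c i * a i j)"
        using J by (intro sum.cong) (auto simp: d_def)
      then show ?thesis using J by (simp add: d_def)
    qed
    have "(\<Sum>i\<in>J. d i * a i j) = 0" if "j \<in> S" for j
    proof -
      have "t * a p j = (\<Sum>i\<in>J'. c i * (a i s / a p s * a p j))"
        by (simp add: t_def sum_divide_distrib sum_distrib_right mult.assoc)
      then show ?thesis using c(2)[OF that] by (simp add: sum_d right_diff_distrib sum_subtractf)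
    qed
    moreover have "(\<Sum>i\<in>J. d i * a i s) = 0" using p by (simp add: sum_d t_def)
    moreover have "\<exists>i\<in>J. d i \<noteq> 0" using c(1) J by (auto simp: d_def)
    ultimately show ?thesis by blast
  qed
qed

text \<open>With more rows than columns in \<open>S\<close>, some nontrivial combination of the rows
  vanishes on \<open>S\<close>. Outside \<open>S\<close> all these rows are zero, so the combination
  is the zero vector, against linear independence.\<close>

lemma card_rows_supported_le:
  assumes "pure A" "finite S"
    and "\<And>i j. i \<in> J \<Longrightarrow> j < dim_col A \<Longrightarrow> A $$ (i, j) \<noteq> 0 \<Longrightarrow> j \<in> S"
    and J: "J \<subseteq> {..<dim_row A}"
  shows "card J \<le> card S"
proof (rule ccontr)
  assume "\<not> card J \<le> card S"
  moreover have finJ: "finite J" using J finite_subset by blast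
  ultimately obtain c where c: "\<exists>i\<in>J. c i \<noteq> 0"
    "\<And>j. j \<in> S \<Longrightarrow> (\<Sum>i\<in>J. c i * rat_of_int (A $$ (i, j))) = 0"
    using underdetermined_homogeneous_system[OF \<open>finite S\<close> finJ, of "\<lambda>i j. rat_of_int (A $$ (i, j))"]
    by auto
  interpret vec_space "TYPE(rat)" "dim_col A" .
  let ?A = "map_mat rat_of_int A"
  have dist: "distinct (rows ?A)" and indpt: "\<not> lin_dep (set (rows ?A))"
    using \<open>pure A\<close> by (auto simp: pure_def Let_def)
  have inj: "inj_on (row ?A) J"
  proof (rule inj_onI)
    fix i k assume ik: "i \<in> J" "k \<in> J" "row ?A i = row ?A k"
    then have "i < dim_row A" "k < dim_row A" using J by auto
    moreover from this have "rows ?A ! i = rows ?A ! k" using ik by (simp add: rows_def)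
    ultimately have "i < length (rows ?A)" "k < length (rows ?A)" "rows ?A ! i = rows ?A ! k"
      by simp_all
    then show "i = k" using dist nth_eq_iff_index_eq by blast
  qed
  \<comment> \<open>\<open>lincomb\<close> takes coefficients indexed by vectors, not by row
    numbers; distinctness of the rows makes the transfer possible.\<close>
  define d where "d = c \<circ> inv_into J (row ?A)"
  have d: "d (row ?A i) = c i" if "i \<in> J" for i using inj that by (simp add: d_def)
  have sub: "row ?A ` J \<subseteq> set (rows ?A)" using J by (auto simp: rows_def)
  have carrier: "row ?A ` J \<subseteq> carrier_vec (dim_col A)" by (auto simp: row_def)
  have "lincomb d (row ?A ` J) = 0\<^sub>v (dim_col A)"
  proof (rule eq_vecI)
    fix j assume "j < dim_vec (0\<^sub>v (dim_col A) :: rat vec)"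
    then have j: "j < dim_col A" by simp
    have "lincomb d (row ?A ` J) $ j = (\<Sum>i\<in>J. d (row ?A i) * row ?A i $ j)"
      using lincomb_index[OF j carrier, of d] sum.reindex[OF inj] by (simp add: o_def)
    also have "\<dots> = (\<Sum>i\<in>J. c i * rat_of_int (A $$ (i, j)))"
      using J j d by (intro sum.cong) auto
    also have "\<dots> = 0"
    proof (cases "j \<in> S")
      case False
      then have "A $$ (i, j) = 0" if "i \<in> J" for i using assms(3)[OF that j] by blast
      then show ?thesis by simp
    qed (rule c)
    finally show "lincomb d (row ?A ` J) $ j = 0\<^sub>v (dim_col A) $ j" using j by simp
  qed (use lincomb_dim[OF finite_imageI[OF finJ] carrier] in simp)
  moreover obtain i where "i \<in> J" "c i \<noteq> 0" using c by blast
  ultimately have "lin_dep (set (rows ?A))"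
    unfolding lin_dep_def using d sub finJ
    by (intro exI[of _ "row ?A ` J"] exI[of _ d] exI[of _ "row ?A i"]) auto
  then show False using indpt by blast
qed

section \<open>The graphs of the extended matrix\<close>

lemma dim_with_identity [simp]:
  "dim_row (with_identity A) = dim_row A" "dim_col (with_identity A) = dim_col A + dim_row A"
  by (auto simp: with_identity_def)

lemma index_with_identity:
  assumes "i < dim_row A" "j < dim_col A + dim_row A"
  shows "with_identity A $$ (i, j) =
    (if j < dim_col A then A $$ (i, j) else if j = dim_col A + i then 1 else 0)"
  using assms by (auto simp: with_identity_def)

lemma pverts_dual_graph: "pverts (dual_graph A) = {..<dim_row A}"
  by (simp add: dual_graph_def primal_graph_def)

lemma parcs_dual_graph:
  "parcs (dual_graph A) = {(i, k). i < dim_row A \<and> k < dim_row A \<and> i \<noteq> k \<and>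
    (\<exists>j<dim_col A. A $$ (i, j) \<noteq> 0 \<and> A $$ (k, j) \<noteq> 0)}"
  by (auto simp: dual_graph_def primal_graph_def)

text \<open>A column of the identity has a single nonzero entry, so it never joins two distinct
  rows.\<close>

lemma dual_graph_with_identity: "dual_graph (with_identity A) = dual_graph A"
proof -
  have "(\<exists>j<dim_col A + dim_row A. with_identity A $$ (i, j) \<noteq> 0 \<and> with_identity A $$ (k, j) \<noteq> 0) \<longleftrightarrow>
        (\<exists>j<dim_col A. A $$ (i, j) \<noteq> 0 \<and> A $$ (k, j) \<noteq> 0)"
    if "i < dim_row A" "k < dim_row A" "i \<noteq> k" for i k
  proof
    assume "\<exists>j<dim_col A. A $$ (i, j) \<noteq> 0 \<and> A $$ (k, j) \<noteq> 0"
    then obtain j where "j < dim_col A" "A $$ (i, j) \<noteq> 0" "A $$ (k, j) \<noteq> 0" by blast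
    then show "\<exists>j<dim_col A + dim_row A. with_identity A $$ (i, j) \<noteq> 0 \<and> with_identity A $$ (k, j) \<noteq> 0"
      using that by (intro exI[of _ j]) (simp add: index_with_identity)
  qed (use that in \<open>auto simp: index_with_identity split: if_splits\<close>)
  then show ?thesis
    by (intro pair_pre_digraph.equality) (auto simp: parcs_dual_graph pverts_dual_graph)
qed

text \<open>The criterion used for both trees. Edges between old columns are inherited from
  \<open>F\<close>, two new columns are never adjacent, and the remaining edges join
  \<open>dim_col A + i\<close> to the support of row \<open>i\<close>.\<close>

lemma primal_graph_with_identity_subgraph_cl:
  assumes F: "td_decomposition (primal_graph A) F"
    and T: "rooted_tree T" "tverts T = {..<dim_col A + dim_row A}"
    and old: "\<And>u v. v < dim_col A \<Longrightarrow> u \<in> root_path F v \<Longrightarrow> u \<in> root_path T v"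
    and new: "\<And>i j. i < dim_row A \<Longrightarrow> j < dim_col A \<Longrightarrow> A $$ (i, j) \<noteq> 0 \<Longrightarrow>
      j \<in> root_path T (dim_col A + i) \<or> dim_col A + i \<in> root_path T j"
  shows "subgraph (with_proj (primal_graph (with_identity A))) (with_proj (cl T))"
proof -
  have F': "\<forall>(u, v) \<in> parcs (primal_graph A). u \<in> root_path F v \<or> v \<in> root_path F u"
  proof (subst subgraph_cl_iff[symmetric])
    show "pverts (primal_graph A) = tverts F" "rooted_tree F"
      "subgraph (with_proj (primal_graph A)) (with_proj (cl F))"
      using F by (simp_all add: td_decomposition_def)
  qed (auto simp: primal_graph_def)
  have "u \<in> root_path T v \<or> v \<in> root_path T u"
    if uv: "(u, v) \<in> parcs (primal_graph (with_identity A))" for u v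
  proof -
    obtain i where i: "i < dim_row A" "with_identity A $$ (i, u) \<noteq> 0" "with_identity A $$ (i, v) \<noteq> 0"
      and b: "u < dim_col A + dim_row A" "v < dim_col A + dim_row A" "u \<noteq> v"
      using uv by (auto simp: primal_graph_def)
    show ?thesis
    proof (cases "u < dim_col A \<and> v < dim_col A")
      case True
      then have "(u, v) \<in> parcs (primal_graph A)"
        using i b by (auto simp: primal_graph_def index_with_identity)
      then show ?thesis using F' old True by blast
    next
      case False
      then show ?thesis using i b new[of i] by (auto simp: index_with_identity split: if_splits)
    qed
  qed
  then show ?thesis
  proof (subst subgraph_cl_iff)
    show "pverts (primal_graph (with_identity A)) = tverts T" using T by (simp add: primal_graph_def)
  qed (use T in \<open>auto simp: primal_graph_def\<close>)
qed

section \<open>Inserting one vertex per row\<close>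

text \<open>Vertex \<open>n + k\<close> is the new column of row \<open>k\<close>. Rows with equal
  \<open>low\<close> stack on one edge, later rows closer to \<open>low k\<close>.\<close>

fun insert_rows :: "nat rtree \<Rightarrow> nat \<Rightarrow> (nat \<Rightarrow> nat) \<Rightarrow> nat \<Rightarrow> nat rtree" where
  "insert_rows F n low 0 = F"
| "insert_rows F n low (Suc k) = insert_above (insert_rows F n low k) (low k) (n + k)"

text \<open>The last conjunct omits \<open>low i\<close>, which lies below \<open>n + i\<close>;
  this one pair is covered by the exact description of the paths of old vertices.\<close>

lemma insert_rows_invariants:
  assumes F: "rooted_tree F" "tverts F = {..<n}" and "\<And>i. i < k \<Longrightarrow> low i < n"
  defines "T \<equiv> insert_rows F n low"
  shows "rooted_tree (T k) \<and> tverts (T k) = {..<n + k} \<and> leaves (T k) = leaves F \<and>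
    (\<forall>u<n. degenerate (T k) u \<longleftrightarrow> degenerate F u) \<and> (\<forall>i<k. degenerate (T k) (n + i)) \<and>
    (\<forall>u<n. root_path (T k) u = root_path F u \<union> (\<lambda>i. n + i) ` {i. i < k \<and> low i \<in> root_path F u}) \<and>
    (\<forall>i<k. root_path F (low i) - {low i} \<subseteq> root_path (T k) (n + i))"
  using assms(3)
proof (induction k)
  case 0
  then show ?case using F by (simp add: T_def)
next
  case (Suc k)
  have l: "low k < n" using Suc.prems by simp
  have rt: "rooted_tree (T k)" and tv: "tverts (T k) = {..<n + k}" and le: "leaves (T k) = leaves F"
    and d1: "\<And>u. u < n \<Longrightarrow> degenerate (T k) u \<longleftrightarrow> degenerate F u"
    and d2: "\<And>i. i < k \<Longrightarrow> degenerate (T k) (n + i)"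
    and rp: "\<And>u. u < n \<Longrightarrow> root_path (T k) u = root_path F u \<union> (\<lambda>i. n + i) ` {i. i < k \<and> low i \<in> root_path F u}"
    and up: "\<And>i. i < k \<Longrightarrow> root_path F (low i) - {low i} \<subseteq> root_path (T k) (n + i)"
    using Suc by auto
  have v: "low k \<in> tverts (T k)" and x: "n + k \<notin> tverts (T k)" using l tv by auto
  have T: "T (Suc k) = insert_above (T k) (low k) (n + k)" by (simp add: T_def)
  note old = root_path_insert_above_old[OF rt v x]
  have "degenerate (T (Suc k)) u \<longleftrightarrow> degenerate F u" if "u < n" for u
    using degenerate_insert_above(1)[OF rt v x] d1[OF that] that tv by (simp add: T)
  moreover have "degenerate (T (Suc k)) (n + i)" if "i < Suc k" for i
    using degenerate_insert_above[OF rt v x] d2[of i] that tv by (cases "i = k") (auto simp: T)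
  moreover have "root_path (T (Suc k)) u =
      root_path F u \<union> (\<lambda>i. n + i) ` {i. i < Suc k \<and> low i \<in> root_path F u}" if u: "u < n" for u
  proof -
    have "low k \<in> root_path (T k) u \<longleftrightarrow> low k \<in> root_path F u" using rp[OF u] l by auto
    moreover have "{i. i < Suc k \<and> low i \<in> root_path F u} =
        {i. i < k \<and> low i \<in> root_path F u} \<union> (if low k \<in> root_path F u then {k} else {})"
      by (auto simp: less_Suc_eq)
    moreover have "u \<in> tverts (T k)" using u tv by simp
    ultimately show ?thesis using old rp[OF u] by (simp add: T Un_assoc image_Un)
  qed
  moreover have "root_path F (low i) - {low i} \<subseteq> root_path (T (Suc k)) (n + i)" if "i < Suc k" for i
  proof (cases "i = k")
    case True
    then show ?thesis using rp[OF l] by (auto simp: T root_path_insert_above_new[OF rt v x])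
  next
    case False
    then show ?thesis using that up[of i] old[of "n + i"] tv by (auto simp: T)
  qed
  ultimately show ?case
    using rooted_tree_insert_above[OF rt v x] leaves_insert_above[OF rt v x] le tv
    by (auto simp: T)
qed

section \<open>The two extended decompositions\<close>

locale row_bottoms =
  fixes A :: "int mat" and F :: "nat rtree" and low :: "nat \<Rightarrow> nat"
  assumes pure: "pure A" and td: "td_decomposition (primal_graph A) F"
    and low_less: "\<And>i. i < dim_row A \<Longrightarrow> low i < dim_col A"
    and support_above: "\<And>i j. i < dim_row A \<Longrightarrow> j < dim_col A \<Longrightarrow> A $$ (i, j) \<noteq> 0 \<Longrightarrow>
      j \<in> root_path F (low i)"
begin

abbreviation "n \<equiv> dim_col A"
abbreviation "m \<equiv> dim_row A"

lemma tree: "rooted_tree F" and tverts: "tverts F = {..<n}"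
  using td by (auto simp: td_decomposition_def primal_graph_def)

lemma graft_rows:
  assumes leaf: "\<And>i. i < m \<Longrightarrow> leaf i \<in> leaves F \<and> low i \<in> root_path F (leaf i)"
  defines "T \<equiv> graft F {n..<n + m} (\<lambda>x. leaf (x - n))"
  shows "tverts T = {..<n + m}" "rooted_tree T"
    "subgraph (with_proj (primal_graph (with_identity A))) (with_proj (cl T))"
    "height T \<le> height F + 1" "topological_height T \<le> topological_height F + 1"
proof -
  note prems = tree finite_atLeastLessThan[of n "n + m"]
  have X: "{n..<n + m} \<inter> tverts F = {}" unfolding tverts disjoint_iff by simp
  have g: "leaf (x - n) \<in> leaves F" if "x \<in> {n..<n + m}" for x
  proof -
    have "x - n < m" using that by auto
    then show ?thesis using leaf by blast
  qed
  show tv: "tverts T = {..<n + m}" unfolding T_def graft_simps tverts by (rule ivl_disj_un_one(2)) simp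
  show rt: "rooted_tree T" unfolding T_def by (rule rooted_tree_graft[OF prems X]) (rule g)
  show "height T \<le> height F + 1" unfolding T_def by (rule height_graft[OF prems X]) (rule g)
  show "topological_height T \<le> topological_height F + 1"
    unfolding T_def by (rule topological_height_graft[OF prems X]) (rule g)
  have old: "root_path T v = root_path F v" if "v < n" for v
    unfolding T_def by (rule root_path_graft_old[OF prems X]) (use g that tverts in simp_all)
  have new: "root_path T x = insert x (root_path F (leaf (x - n)))" if "x \<in> {n..<n + m}" for x
    unfolding T_def by (rule root_path_graft_new[OF prems X]) (use g that in simp_all)
  show "subgraph (with_proj (primal_graph (with_identity A))) (with_proj (cl T))"
  proof (rule primal_graph_with_identity_subgraph_cl[OF td rt tv])
    fix u v assume "v < n" "u \<in> root_path F v"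
    then show "u \<in> root_path T v"
      by (simp add: old)
  next
    fix i j assume ij: "i < m" "j < n" "A $$ (i, j) \<noteq> 0"
    have "j \<in> root_path F (leaf i)"
      using support_above[OF ij] leaf[OF ij(1)] root_path_trans by fast
    then have "j \<in> root_path T (n + i)"
      using ij by (simp add: new)
    then show "j \<in> root_path T (n + i) \<or> n + i \<in> root_path T j" ..
  qed
qed

text \<open>If \<open>low i\<close> lies on the path of \<open>v\<close>, so does the whole support
  of row \<open>i\<close>; the rank bound then applies with the path as column set. This is the
  source of the factor 2 in the height.\<close>

lemma card_rows_on_root_path:
  assumes "v < n"
  shows "card {i. i < m \<and> low i \<in> root_path F v} \<le> card (root_path F v)"
proof (rule card_rows_supported_le[OF pure])
  show "finite (root_path F v)" using finite_root_path[OF tree] assms tverts by auto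
  fix i j assume "i \<in> {i. i < m \<and> low i \<in> root_path F v}" "j < n" "A $$ (i, j) \<noteq> 0"
  then show "j \<in> root_path F v" using support_above[of i j] root_path_trans by fast
qed auto

lemma insert_rows_props:
  defines "T \<equiv> insert_rows F n low m"
  shows "tverts T = {..<n + m}" "rooted_tree T"
    "subgraph (with_proj (primal_graph (with_identity A))) (with_proj (cl T))"
    "height T \<le> 2 * height F" "topological_height T = topological_height F"
proof -
  have inv: "rooted_tree T" "tverts T = {..<n + m}" "leaves T = leaves F"
    "\<And>u. u < n \<Longrightarrow> degenerate T u \<longleftrightarrow> degenerate F u" "\<And>i. i < m \<Longrightarrow> degenerate T (n + i)"
    "\<And>u. u < n \<Longrightarrow> root_path T u = root_path F u \<union> (\<lambda>i. n + i) ` {i. i < m \<and> low i \<in> root_path F u}"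
    "\<And>i. i < m \<Longrightarrow> root_path F (low i) - {low i} \<subseteq> root_path T (n + i)"
    using insert_rows_invariants[OF tree tverts, of m low] low_less by (auto simp: T_def)
  show "tverts T = {..<n + m}" "rooted_tree T" by (fact inv)+
  have leaf_less: "w < n" if "w \<in> leaves F" for w using that tverts by (auto simp: leaves_def)
  show "subgraph (with_proj (primal_graph (with_identity A))) (with_proj (cl T))"
  proof (rule primal_graph_with_identity_subgraph_cl[OF td inv(1,2)])
    fix i j assume ij: "i < m" "j < n" "A $$ (i, j) \<noteq> 0"
    show "j \<in> root_path T (n + i) \<or> n + i \<in> root_path T j"
    \<comment> \<open>The lowest column has \<open>n + i\<close> as an ancestor; every other column
      of the support is an ancestor of \<open>n + i\<close>.\<close>
    proof (cases "j = low i")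
      case True
      then show ?thesis using inv(6)[of j] ij by auto
    next
      case False
      then show ?thesis using inv(7)[of i] support_above[OF ij] ij by auto
    qed
  qed (use inv(6) in auto)
  have "card (root_path T w) \<le> 2 * height F" if w: "w \<in> leaves F" for w
  proof -
    let ?I = "{i. i < m \<and> low i \<in> root_path F w}"
    have "card (root_path T w) \<le> card (root_path F w) + card ((\<lambda>i. n + i) ` ?I)"
      using inv(6)[OF leaf_less[OF w]] card_Un_le by simp
    also have "card ((\<lambda>i. n + i) ` ?I) \<le> card ?I" by (rule card_image_le) simp
    also have "card ?I \<le> card (root_path F w)"
      by (rule card_rows_on_root_path[OF leaf_less[OF w]])
    finally show ?thesis using height_le_iff[OF tree, of "height F"] w by fastforce
  qed
  then show "height T \<le> 2 * height F" using height_le_iff[OF inv(1)] inv(3) by simp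
  have "{u \<in> root_path T w. \<not> degenerate T u} = {u \<in> root_path F w. \<not> degenerate F u}"
    if w: "w \<in> leaves F" for w
  proof -
    have "root_path F w \<subseteq> {..<n}" using root_path_subset[OF tree] leaf_less[OF w] tverts by simp
    then show ?thesis using inv(4,5) inv(6)[OF leaf_less[OF w]] by auto
  qed
  then show "topological_height T = topological_height F"
    unfolding topological_height_def inv(3) by (metis (no_types, lifting) image_cong)
qed

lemma dim_row_le_dim_col: "m \<le> n"
  using card_rows_supported_le[OF pure, of "{..<n}" "{..<m}"] by simp

end

section \<open>Running times of loops with loop-free bodies\<close>

text \<open>For bodies without loops the effect is a function that simplification can evaluate, and
  the time is bounded independently of the store.\<close>

primrec loop_free :: "com \<Rightarrow> bool" where
  "loop_free Skip \<longleftrightarrow> True"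
| "loop_free (Assign x e) \<longleftrightarrow> True"
| "loop_free (AssignElem a i e) \<longleftrightarrow> True"
| "loop_free (Seq c1 c2) \<longleftrightarrow> loop_free c1 \<and> loop_free c2"
| "loop_free (IfPos e c1 c2) \<longleftrightarrow> loop_free c1 \<and> loop_free c2"
| "loop_free (WhilePos e c) \<longleftrightarrow> False"

text \<open>The values of \<open>run\<close> and \<open>max_cost\<close> on loops are junk.\<close>

primrec run :: "com \<Rightarrow> store \<Rightarrow> store" where
  "run Skip s = s"
| "run (Assign x e) s = s\<lparr>var := (var s)(x := aval s e)\<rparr>"
| "run (AssignElem a i e) s = s\<lparr>arr := (arr s)(a := (arr s a)(aval s i := aval s e))\<rparr>"
| "run (Seq c1 c2) s = run c2 (run c1 s)"
| "run (IfPos e c1 c2) s = (if aval s e > 0 then run c1 s else run c2 s)"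
| "run (WhilePos e c) s = s"

primrec max_cost :: "com \<Rightarrow> nat" where
  "max_cost Skip = 1"
| "max_cost (Assign x e) = 1 + cost e"
| "max_cost (AssignElem a i e) = 1 + cost i + cost e"
| "max_cost (Seq c1 c2) = max_cost c1 + max_cost c2"
| "max_cost (IfPos e c1 c2) = 1 + cost e + max (max_cost c1) (max_cost c2)"
| "max_cost (WhilePos e c) = 0"

lemma exec_run: "loop_free c \<Longrightarrow> \<exists>t \<le> max_cost c. exec c s t (run c s)"
proof (induction c arbitrary: s)
  case (Seq c1 c2)
  then obtain t1 t2 where "t1 \<le> max_cost c1" "exec c1 s t1 (run c1 s)"
    "t2 \<le> max_cost c2" "exec c2 (run c1 s) t2 (run c2 (run c1 s))"
    by (meson loop_free.simps(4))
  then show ?case using exec.Seq by (intro exI[of _ "t1 + t2"]) auto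
next
  case (IfPos e c1 c2)
  show ?case
  proof (cases "aval s e > 0")
    case True
    obtain t where "t \<le> max_cost c1" "exec c1 s t (run c1 s)" using IfPos by auto
    then show ?thesis using exec.IfTrue[OF True, of c1 t] True
      by (intro exI[of _ "1 + cost e + t"]) auto
  next
    case False
    obtain t where "t \<le> max_cost c2" "exec c2 s t (run c2 s)" using IfPos by auto
    then show ?thesis using exec.IfFalse[OF False, of c2 t] False
      by (intro exI[of _ "1 + cost e + t"]) auto
  qed
next
  case Skip
  then show ?case using exec.Skip by (intro exI[of _ 1]) simp
next
  case (Assign x e)
  then show ?case using exec.Assign by (intro exI[of _ "1 + cost e"]) simp
next
  case (AssignElem a i e)
  then show ?case using exec.AssignElem by (intro exI[of _ "1 + cost i + cost e"]) simp
qed simp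

definition halts_within :: "nat \<Rightarrow> com \<Rightarrow> store \<Rightarrow> (store \<Rightarrow> bool) \<Rightarrow> bool" where
  "halts_within b c s Q \<longleftrightarrow> (\<exists>t s'. exec c s t s' \<and> t \<le> b \<and> Q s')"

lemma halts_within_run: "loop_free c \<Longrightarrow> Q (run c s) \<Longrightarrow> halts_within (max_cost c) c s Q"
  using exec_run[of c s] by (auto simp: halts_within_def)

lemma halts_within_Seq:
  assumes "halts_within b1 c1 s Q" "\<And>s'. Q s' \<Longrightarrow> halts_within b2 c2 s' R"
  shows "halts_within (b1 + b2) (Seq c1 c2) s R"
proof -
  obtain t1 s1 where 1: "exec c1 s t1 s1" "t1 \<le> b1" "Q s1"
    using assms(1) by (auto simp: halts_within_def)
  obtain t2 s2 where 2: "exec c2 s1 t2 s2" "t2 \<le> b2" "R s2"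
    using assms(2)[OF 1(3)] by (auto simp: halts_within_def)
  have "exec (Seq c1 c2) s (t1 + t2) s2" by (rule exec.Seq[OF 1(1) 2(1)])
  then show ?thesis unfolding halts_within_def using 1 2
    by (intro exI[of _ "t1 + t2"] exI[of _ s2]) auto
qed

lemma halts_within_mono:
  "halts_within b c s Q \<Longrightarrow> b \<le> b' \<Longrightarrow> (\<And>s'. Q s' \<Longrightarrow> R s') \<Longrightarrow> halts_within b' c s R"
  unfolding halts_within_def using le_trans by blast

text \<open>Each round pays for one test and one body and lowers the measure; the extra
  \<open>+ 1\<close> pays for the final failing test.\<close>

lemma halts_within_WhilePos:
  assumes c: "loop_free c" and "I s"
    and step: "\<And>s. I s \<Longrightarrow> aval s e > 0 \<Longrightarrow> I (run c s) \<and> \<mu> (run c s) < (\<mu> s :: nat)"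
  shows "halts_within ((1 + cost e + max_cost c) * (\<mu> s + 1)) (WhilePos e c) s
    (\<lambda>s'. I s' \<and> \<not> aval s' e > 0)"
  using \<open>I s\<close>
proof (induction "\<mu> s" arbitrary: s rule: less_induct)
  case less
  let ?K = "1 + cost e + max_cost c"
  show ?case
  proof (cases "aval s e > 0")
    case True
    note st = step[OF less.prems True]
    obtain t1 where t1: "t1 \<le> max_cost c" "exec c s t1 (run c s)" using exec_run[OF c] by blast
    obtain t2 s' where t2: "exec (WhilePos e c) (run c s) t2 s'" "t2 \<le> ?K * (\<mu> (run c s) + 1)"
      "I s'" "\<not> aval s' e > 0"
      using less.hyps[of "run c s"] st by (auto simp: halts_within_def)
    have "t2 \<le> ?K * \<mu> s" using t2(2) st mult_le_mono2[of "\<mu> (run c s) + 1" "\<mu> s" ?K] by linarith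
    then have "1 + cost e + t1 + t2 \<le> ?K * (\<mu> s + 1)" using t1(1) by simp
    then show ?thesis
      using exec.WhileTrue[OF True t1(2) t2(1)] t2(3,4) unfolding halts_within_def by blast
  next
    case False
    have "1 + cost e \<le> ?K * (\<mu> s + 1)" by simp
    then show ?thesis
      using exec.WhileFalse[OF False, of c] less.prems False unfolding halts_within_def by blast
  qed
qed

definition for_loop :: "string \<Rightarrow> com \<Rightarrow> com" where
  "for_loop bound c = Seq (Assign ''i'' (Num 0))
     (WhilePos (Minus (Var bound) (Var ''i'')) (Seq c (Assign ''i'' (Plus (Var ''i'') (Num 1)))))"

text \<open>\<open>J k\<close> describes the store before round \<open>k\<close>. Test and increment
  cost 8 per round and initialisation costs 2, so 20 is a generous allowance.\<close>

lemma halts_within_for_loop: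
  fixes J :: "nat \<Rightarrow> store \<Rightarrow> bool"
  assumes c: "loop_free c" and bound: "bound \<noteq> ''i''"
    and init: "J 0 (s\<lparr>var := (var s)(''i'' := 0)\<rparr>)"
    and J: "\<And>k s. J k s \<Longrightarrow> var s bound = int N \<and> var s ''i'' = int k"
    and step: "\<And>k s s'. J k s \<Longrightarrow> k < N \<Longrightarrow> s' = run c s \<Longrightarrow>
      J (Suc k) (s'\<lparr>var := (var s')(''i'' := var s' ''i'' + 1)\<rparr>)"
  shows "halts_within ((20 + max_cost c) * (N + 1)) (for_loop bound c) s (J N)"
proof -
  let ?e = "Minus (Var bound) (Var ''i'')"
  let ?c = "Seq c (Assign ''i'' (Plus (Var ''i'') (Num 1)))"
  let ?s = "s\<lparr>var := (var s)(''i'' := 0)\<rparr>"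
  let ?I = "\<lambda>s. \<exists>k\<le>N. J k s"
  have loop: "halts_within ((1 + cost ?e + max_cost ?c) * (nat (aval ?s ?e) + 1)) (WhilePos ?e ?c) ?s
    (\<lambda>s'. ?I s' \<and> \<not> aval s' ?e > 0)"
  proof (rule halts_within_WhilePos)
    show "loop_free ?c" using c by simp
    show "?I ?s" using init by blast
    fix s assume "?I s" and pos: "aval s ?e > 0"
    then obtain k where k: "J k s" by blast
    have "k < N" using J[OF k] pos by simp
    then have J': "J (Suc k) (run ?c s)" using step[OF k] by simp
    show "?I (run ?c s) \<and> nat (aval (run ?c s) ?e) < nat (aval s ?e)"
      using J' J[OF J'] J[OF k] \<open>k < N\<close> by (auto intro!: exI[of _ "Suc k"])
  qed
  have "nat (aval ?s ?e) = N" using J[OF init] by simp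
  then have le: "(1 + cost ?e + max_cost ?c) * (nat (aval ?s ?e) + 1) \<le> (10 + max_cost c) * (N + 1)"
    by (intro mult_le_mono) simp_all
  have loop: "halts_within ((10 + max_cost c) * (N + 1)) (WhilePos ?e ?c) ?s (J N)"
  proof (rule halts_within_mono[OF loop le])
    fix s' assume "?I s' \<and> \<not> aval s' ?e > 0"
    then obtain k where "J k s'" "k \<le> N" "\<not> aval s' ?e > 0" by blast
    then show "J N s'" using J[of k s'] by simp
  qed
  have "halts_within 2 (Assign ''i'' (Num 0)) s (\<lambda>s'. s' = ?s)"
    using halts_within_run[of "Assign ''i'' (Num 0)" "\<lambda>s'. s' = ?s" s]
    by (simp add: numeral_2_eq_2)
  then have "halts_within (2 + (10 + max_cost c) * (N + 1)) (for_loop bound c) s (J N)"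
    unfolding for_loop_def by (rule halts_within_Seq) (simp only: loop)
  then show ?thesis by (rule halts_within_mono) (simp_all add: algebra_simps)
qed

section \<open>The program\<close>

text \<open>Memory is not initialised, so the working arrays must be cleared; \<open>-1\<close> in
  \<open>leaf\<close> means that no leaf is known yet.\<close>

definition copy_row :: com where
  "copy_row = Seq (AssignElem ''parent1'' (Var ''i'') (Elem ''parent'' (Var ''i'')))
    (Seq (AssignElem ''parent2'' (Var ''i'') (Elem ''parent'' (Var ''i'')))
    (Seq (AssignElem ''inner'' (Var ''i'') (Num 0))
    (AssignElem ''leaf'' (Var ''i'') (Num (-1)))))"

text \<open>The root is its own parent, which does not count as having a child.\<close>

definition mark_inner :: com where
  "mark_inner = Seq (Assign ''x'' (Elem ''parent'' (Var ''i'')))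
    (IfPos (Minus (Var ''x'') (Var ''i'')) (AssignElem ''inner'' (Var ''x'') (Num 1))
    (IfPos (Minus (Var ''i'') (Var ''x'')) (AssignElem ''inner'' (Var ''x'') (Num 1)) Skip))"

definition next_leaf :: com where
  "next_leaf = Seq (Assign ''i'' (Plus (Var ''i'') (Num 1))) (Assign ''x'' (Var ''i''))"

text \<open>
  From each leaf \<open>i\<close> in turn, \<open>x\<close> walks towards the root until it meets a vertex that already
  knows a leaf below it. Every vertex is labelled once, so all walks together take linear time.
\<close>

definition label_step :: com where
  "label_step = IfPos (Elem ''inner'' (Var ''i'')) next_leaf
    (IfPos (Minus (Num 0) (Elem ''leaf'' (Var ''x'')))
      (Seq (AssignElem ''leaf'' (Var ''x'') (Var ''i''))
        (Assign ''x'' (Elem ''parent'' (Var ''x''))))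
      next_leaf)"

text \<open>The nested search (over leaves, then along a path) is flattened into one loop, which
  keeps its body loop-free and lets one potential bound the total number of rounds.\<close>

definition label_leaves :: com where
  "label_leaves = Seq (Seq (Assign ''i'' (Num 0)) (Assign ''x'' (Num 0)))
     (WhilePos (Minus (Var ''columns'') (Var ''i'')) label_step)"

text \<open>\<open>v\<close> becomes \<open>low i\<close>, the first listed column of the row, and
  \<open>x\<close> the new vertex. The parent \<open>p\<close> is read from \<open>parent2\<close>,
  as earlier rows may have changed it. The two positivity tests decide whether \<open>p\<close>
  differs from \<open>v\<close>; equality means that \<open>v\<close> is the current root.\<close>

definition attach_row :: com where
  "attach_row = Seq (Assign ''v'' (Elem ''colind'' (Elem ''rowptr'' (Var ''i''))))
    (Seq (Assign ''x'' (Plus (Var ''columns'') (Var ''i'')))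
    (Seq (AssignElem ''parent1'' (Var ''x'') (Elem ''leaf'' (Var ''v'')))
    (Seq (Assign ''p'' (Elem ''parent2'' (Var ''v'')))
    (Seq (IfPos (Minus (Var ''p'') (Var ''v'')) (AssignElem ''parent2'' (Var ''x'') (Var ''p''))
      (IfPos (Minus (Var ''v'') (Var ''p'')) (AssignElem ''parent2'' (Var ''x'') (Var ''p''))
        (AssignElem ''parent2'' (Var ''x'') (Var ''x''))))
    (AssignElem ''parent2'' (Var ''v'') (Var ''x''))))))"

definition extend_trees :: com where
  "extend_trees = Seq (for_loop ''columns'' copy_row)
     (Seq (for_loop ''columns'' mark_inner)
     (Seq label_leaves (for_loop ''rows'' attach_row)))"

text \<open>One constant that dominates the cost per round in all four phases.\<close>

definition step_cost :: nat where
  "step_cost = 80 + max_cost copy_row + max_cost mark_inner + max_cost label_step + max_cost attach_row"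

locale program_input =
  fixes n m :: nat and F :: "nat rtree" and low :: "nat \<Rightarrow> nat"
  assumes F: "rooted_tree F" "tverts F = {..<n}" and low: "\<And>i. i < m \<Longrightarrow> low i < n"
begin

abbreviation par :: "nat \<Rightarrow> nat" where "par \<equiv> tparent F"

definition input :: "store \<Rightarrow> bool" where
  "input s \<longleftrightarrow> var s ''rows'' = int m \<and> var s ''columns'' = int n \<and>
     (\<forall>v<n. arr s ''parent'' (int v) = int (par v)) \<and>
     (\<forall>i<m. arr s ''colind'' (arr s ''rowptr'' (int i)) = int (low i))"

definition copied :: "nat \<Rightarrow> store \<Rightarrow> bool" where
  "copied k s \<longleftrightarrow> input s \<and> (\<forall>v<k. arr s ''parent1'' (int v) = int (par v) \<and>
     arr s ''parent2'' (int v) = int (par v))"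

lemma par_less: "v < n \<Longrightarrow> par v < n"
  using F by (auto simp: rooted_tree_def)

section \<open>Initialising the working arrays\<close>

lemma copy_loop:
  assumes "input s"
  shows "halts_within ((20 + max_cost copy_row) * (n + 1)) (for_loop ''columns'' copy_row) s
    (\<lambda>s. copied n s \<and> (\<forall>v<n. arr s ''inner'' (int v) = 0 \<and> arr s ''leaf'' (int v) = -1))"
proof -
  have "halts_within ((20 + max_cost copy_row) * (n + 1)) (for_loop ''columns'' copy_row) s
    ((\<lambda>k s. var s ''i'' = int k \<and> copied k s \<and>
        (\<forall>v<k. arr s ''inner'' (int v) = 0 \<and> arr s ''leaf'' (int v) = -1)) n)"
    using assms
    by (intro halts_within_for_loop)
      (auto simp: copied_def input_def copy_row_def less_Suc_eq)
  then show ?thesis by (rule halts_within_mono) auto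
qed

section \<open>Telling inner vertices from leaves\<close>

definition inner_upto :: "nat \<Rightarrow> nat \<Rightarrow> bool" where
  "inner_upto k v \<longleftrightarrow> (\<exists>u<k. par u = v \<and> u \<noteq> v)"

lemma inner_upto_Suc: "inner_upto (Suc k) v \<longleftrightarrow> inner_upto k v \<or> par k = v \<and> k \<noteq> v"
  by (auto simp: inner_upto_def less_Suc_eq)

text \<open>The program excludes self-parents where \<open>children\<close> excludes the root; in a
  rooted tree only the root is its own parent.\<close>

lemma inner_upto_iff_not_leaf: "v < n \<Longrightarrow> inner_upto n v \<longleftrightarrow> v \<notin> leaves F"
proof -
  have "u \<noteq> troot F \<longleftrightarrow> par u \<noteq> u" if "u < n" for u
    using parent_neq[OF F(1), of u] F(2) that by simp
  then have "children F v = {u. u < n \<and> par u = v \<and> u \<noteq> v}"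
    unfolding children_def F(2) by fastforce
  moreover assume "v < n"
  ultimately show ?thesis using F(2) by (auto simp: inner_upto_def leaves_def)
qed

lemma inner_loop:
  assumes "copied n s" "\<forall>v<n. arr s ''inner'' (int v) = 0 \<and> arr s ''leaf'' (int v) = -1"
  shows "halts_within ((20 + max_cost mark_inner) * (n + 1)) (for_loop ''columns'' mark_inner) s
    (\<lambda>s. copied n s \<and> (\<forall>v<n. arr s ''leaf'' (int v) = -1) \<and>
      (\<forall>v<n. arr s ''inner'' (int v) > 0 \<longleftrightarrow> v \<notin> leaves F))"
proof -
  let ?J = "\<lambda>k s. var s ''i'' = int k \<and> copied n s \<and> (\<forall>v<n. arr s ''leaf'' (int v) = -1) \<and>
      (\<forall>v<n. arr s ''inner'' (int v) > 0 \<longleftrightarrow> inner_upto k v)"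
  have "halts_within ((20 + max_cost mark_inner) * (n + 1)) (for_loop ''columns'' mark_inner) s (?J n)"
  proof (rule halts_within_for_loop[where J = ?J])
    fix k s s' assume J: "?J k s" and k: "k < n" and s': "s' = run mark_inner s"
    have par: "arr s ''parent'' (int k) = int (par k)" using J k by (simp add: copied_def input_def)
    then show "?J (Suc k) (s'\<lparr>var := (var s')(''i'' := var s' ''i'' + 1)\<rparr>)"
      using J k par_less[OF k] s'
      by (auto simp: copied_def input_def mark_inner_def inner_upto_Suc)
  qed (use assms in \<open>auto simp: copied_def input_def mark_inner_def inner_upto_def\<close>)
  then show ?thesis by (rule halts_within_mono) (auto simp: inner_upto_iff_not_leaf)
qed

section \<open>Finding a leaf below every vertex\<close>

definition labels :: "store \<Rightarrow> nat \<Rightarrow> bool" where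
  "labels s v \<longleftrightarrow> arr s ''leaf'' (int v) \<ge> 0"

text \<open>The labelled set is closed under parents except possibly at the current position
  \<open>x\<close> of a walk from leaf \<open>i\<close>. Leaf \<open>i\<close> counts as done once
  the walk has left it. At \<open>i = n\<close> the exception is void.\<close>

definition label_invariant :: "store \<Rightarrow> bool" where
  "label_invariant s \<longleftrightarrow> copied n s \<and>
     (\<forall>v<n. arr s ''inner'' (int v) > 0 \<longleftrightarrow> v \<notin> leaves F) \<and>
     (\<forall>v<n. labels s v \<longrightarrow> (\<exists>w \<in> leaves F. arr s ''leaf'' (int v) = int w \<and> v \<in> root_path F w)) \<and>
     (\<exists>i x. var s ''i'' = int i \<and> var s ''x'' = int x \<and> i \<le> n \<and>
        (i < n \<longrightarrow> x \<in> root_path F i) \<and>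
        (\<forall>w<n. w \<in> leaves F \<and> (w < i \<or> w = i \<and> x \<noteq> i) \<longrightarrow> labels s w) \<and>
        (\<forall>v<n. labels s v \<longrightarrow> labels s (par v) \<or> i < n \<and> i \<in> leaves F \<and> par v = x))"

definition unlabelled :: "store \<Rightarrow> nat set" where
  "unlabelled s = {v. v < n \<and> \<not> labels s v}"

text \<open>A walk stops at a labelled \<open>x\<close>, which removes the only possible gap in
  upward closure; if \<open>i\<close> is no leaf, there is no gap.\<close>

lemma label_step_next:
  assumes "label_invariant s" "var s ''i'' = int i" "i < n" "var s ''x'' = int x"
    and stop: "i \<notin> leaves F \<or> labels s x"
  shows "label_invariant (run next_leaf s)"
    "var (run next_leaf s) ''i'' = int i + 1" "unlabelled (run next_leaf s) = unlabelled s"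
proof -
  have lab: "labels (run next_leaf s) = labels s"
    by (simp add: labels_def next_leaf_def fun_eq_iff)
  show "var (run next_leaf s) ''i'' = int i + 1" using assms(2) by (simp add: next_leaf_def)
  show "unlabelled (run next_leaf s) = unlabelled s" by (simp add: unlabelled_def lab)
  have "w \<in> leaves F \<Longrightarrow> w < Suc i \<Longrightarrow> labels s w" if "w < n" for w
    using assms that unfolding label_invariant_def by (auto simp: less_Suc_eq)
  moreover have "labels s v \<Longrightarrow> labels s (par v)" if "v < n" for v
    using assms that unfolding label_invariant_def by auto
  ultimately show "label_invariant (run next_leaf s)"
    using assms(1,2,3) unfolding label_invariant_def lab
    by (intro conjI exI[of _ "Suc i"])
      (auto simp: next_leaf_def copied_def input_def)
qed

lemma label_step_mark:
  assumes inv: "label_invariant s" and i: "var s ''i'' = int i" "i < n" and x: "var s ''x'' = int x"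
    and leaf: "i \<in> leaves F" and unl: "\<not> labels s x"
    and s': "s' = run (Seq (AssignElem ''leaf'' (Var ''x'') (Var ''i''))
        (Assign ''x'' (Elem ''parent'' (Var ''x'')))) s"
  shows "label_invariant s'" "var s' ''i'' = int i" "unlabelled s' = unlabelled s - {x}" "x \<in> unlabelled s"
proof -
  have xi: "x \<in> root_path F i" using inv i x by (auto simp: label_invariant_def)
  then have xn: "x < n" using root_path_subset[OF F(1)] F(2) i(2) by auto
  have px: "arr s ''parent'' (int x) = int (par x)"
    using inv xn by (auto simp: label_invariant_def copied_def input_def)
  have lab: "labels s' v \<longleftrightarrow> v = x \<or> labels s v" for v
    using i x by (auto simp: labels_def s')
  show "var s' ''i'' = int i" using i by (simp add: s')
  show "unlabelled s' = unlabelled s - {x}" by (auto simp: unlabelled_def lab)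
  show "x \<in> unlabelled s" using unl xn by (simp add: unlabelled_def)
  have cop: "copied n s'" "\<forall>v<n. arr s' ''inner'' (int v) > 0 \<longleftrightarrow> v \<notin> leaves F"
    using inv by (auto simp: label_invariant_def copied_def input_def s')
  have old: "labels s v \<Longrightarrow> \<exists>w \<in> leaves F. arr s ''leaf'' (int v) = int w \<and> v \<in> root_path F w"
    if "v < n" for v using inv that unfolding label_invariant_def by blast
  have val: "\<exists>w \<in> leaves F. arr s' ''leaf'' (int v) = int w \<and> v \<in> root_path F w"
    if "v < n" "labels s' v" for v
  proof (cases "v = x")
    case True
    then show ?thesis using xi leaf i x by (auto simp: s')
  next
    case False
    then have "labels s v" using that lab by simp
    moreover have "arr s' ''leaf'' (int v) = arr s ''leaf'' (int v)" using False x by (simp add: s')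
    ultimately show ?thesis using old[OF that(1)] by simp
  qed
  have reached: "labels s' w" if "w < n" "w \<in> leaves F" "w \<le> i" for w
    using inv i x that unfolding label_invariant_def lab by (auto simp: le_less)
  \<comment> \<open>The old gap at \<open>x\<close> is now filled, so the only possible gap has
    moved to \<open>par x\<close>, the new position of the walk.\<close>
  have closed: "labels s' (par v) \<or> par v = par x" if "v < n" "labels s' v" for v
    using inv i x that unfolding label_invariant_def lab by auto
  have "\<exists>i x. var s' ''i'' = int i \<and> var s' ''x'' = int x \<and> i \<le> n \<and>
      (i < n \<longrightarrow> x \<in> root_path F i) \<and>
      (\<forall>w<n. w \<in> leaves F \<and> (w < i \<or> w = i \<and> x \<noteq> i) \<longrightarrow> labels s' w) \<and>
      (\<forall>v<n. labels s' v \<longrightarrow> labels s' (par v) \<or> i < n \<and> i \<in> leaves F \<and> par v = x)"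
  proof (rule exI[of _ i], rule exI[of _ "par x"], intro conjI)
    show "var s' ''i'' = int i" using i by (simp add: s')
    show "var s' ''x'' = int (par x)" using x px by (simp add: s')
    show "i < n \<longrightarrow> par x \<in> root_path F i" using root_path_step[OF xi] by simp
  qed (use reached closed i leaf in auto)
  then show "label_invariant s'" unfolding label_invariant_def using cop val by blast
qed

lemma label_loop:
  assumes "copied n s" "\<forall>v<n. arr s ''leaf'' (int v) = -1"
    "\<forall>v<n. arr s ''inner'' (int v) > 0 \<longleftrightarrow> v \<notin> leaves F"
  shows "halts_within ((20 + max_cost label_step) * (2 * n + 1)) label_leaves s
    (\<lambda>s. copied n s \<and>
      (\<forall>v<n. \<exists>w \<in> leaves F. arr s ''leaf'' (int v) = int w \<and> v \<in> root_path F w))"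
proof -
  let ?e = "Minus (Var ''columns'') (Var ''i'')"
  let ?init = "Seq (Assign ''i'' (Num 0)) (Assign ''x'' (Num 0))"
  \<comment> \<open>Every round either advances \<open>i\<close> or labels a new vertex, so this
    potential, at most \<open>2 * n\<close>, drops each time.\<close>
  let ?\<mu> = "\<lambda>s. nat (aval s ?e) + card (unlabelled s)"
  have fin: "finite (unlabelled s)" for s by (simp add: unlabelled_def)
  have "label_invariant (run ?init s)"
    using assms unfolding label_invariant_def
    by (intro conjI exI[of _ "0::nat"]) (auto simp: copied_def input_def labels_def)
  then have "halts_within (max_cost ?init) ?init s label_invariant"
    by (intro halts_within_run) simp_all
  moreover have "halts_within ((20 + max_cost label_step) * (2 * n + 1) - max_cost ?init)
      (WhilePos ?e label_step) s
      (\<lambda>s. copied n s \<and> (\<forall>v<n. \<exists>w \<in> leaves F. arr s ''leaf'' (int v) = int w \<and> v \<in> root_path F w))"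
    if inv: "label_invariant s" for s
  proof (rule halts_within_mono)
    show "halts_within ((1 + cost ?e + max_cost label_step) * (?\<mu> s + 1)) (WhilePos ?e label_step) s
      (\<lambda>s'. label_invariant s' \<and> \<not> aval s' ?e > 0)"
    proof (rule halts_within_WhilePos[where I = label_invariant and \<mu> = ?\<mu>])
      show "loop_free label_step" by (simp add: label_step_def next_leaf_def)
      show "label_invariant s" by (rule inv)
      fix s assume inv: "label_invariant s" and pos: "aval s ?e > 0"
      obtain i x where i: "var s ''i'' = int i" "var s ''x'' = int x"
        using inv unfolding label_invariant_def by blast
      have col: "var s ''columns'' = int n" if "label_invariant s" for s
        using that by (simp add: label_invariant_def copied_def input_def)
      have "i < n" using pos i col[OF inv] by simp
      have inn: "arr s ''inner'' (int i) > 0 \<longleftrightarrow> i \<notin> leaves F"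
        using inv \<open>i < n\<close> by (simp add: label_invariant_def)
      show "label_invariant (run label_step s) \<and> ?\<mu> (run label_step s) < ?\<mu> s"
      proof (cases "i \<notin> leaves F \<or> labels s x")
        case True
        then have "run label_step s = run next_leaf s"
          using inn i by (auto simp: label_step_def labels_def)
        then show ?thesis
          using label_step_next[OF inv i(1) \<open>i < n\<close> i(2) True] col[OF inv] col \<open>i < n\<close> i
          by simp
      next
        case False
        have eq: "run label_step s = run (Seq (AssignElem ''leaf'' (Var ''x'') (Var ''i''))
            (Assign ''x'' (Elem ''parent'' (Var ''x'')))) s"
          using False inn i by (simp add: label_step_def labels_def)
        note mark = label_step_mark[OF inv i(1) \<open>i < n\<close> i(2) _ _ eq]
        have "card (unlabelled (run label_step s)) < card (unlabelled s)"
          using mark(3,4) False card_Diff1_less[OF fin] by auto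
        then show ?thesis using mark(1,2) False col[OF inv] col i by simp
      qed
    qed
    have "card (unlabelled s) \<le> card {..<n}" by (intro card_mono) (auto simp: unlabelled_def)
    moreover have "nat (aval s ?e) \<le> n"
      using inv by (auto simp: label_invariant_def copied_def input_def)
    ultimately have "?\<mu> s + 1 \<le> 2 * n + 1" by simp
    then have "(1 + cost ?e + max_cost label_step) * (?\<mu> s + 1) \<le>
        (4 + max_cost label_step) * (2 * n + 1)"
      by (intro mult_mono) simp_all
    also have "\<dots> \<le> (20 + max_cost label_step) * (2 * n + 1) - max_cost ?init"
      by (simp add: algebra_simps)
    finally show "(1 + cost ?e + max_cost label_step) * (?\<mu> s + 1) \<le>
        (20 + max_cost label_step) * (2 * n + 1) - max_cost ?init" .
  next
    fix s assume s: "label_invariant s \<and> \<not> aval s ?e > 0"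
    then have "var s ''columns'' = int n" by (simp add: label_invariant_def copied_def input_def)
    then have all: "\<forall>w<n. w \<in> leaves F \<longrightarrow> labels s w" "\<forall>v<n. labels s v \<longrightarrow> labels s (par v)"
      using s unfolding label_invariant_def by auto
    have "\<exists>w \<in> leaves F. arr s ''leaf'' (int v) = int w \<and> v \<in> root_path F w" if v: "v < n" for v
    proof -
      obtain w where w: "w \<in> leaves F" "v \<in> root_path F w"
        using exists_leaf_below[OF F(1)] v F(2) by auto
      \<comment> \<open>All leaves are labelled and labels are closed under parents, so the labels
        reach every vertex from a leaf below it.\<close>
      have "root_path F w \<subseteq> {u. u < n \<and> labels s u}"
      proof (rule root_path_least)
        show "w \<in> {u. u < n \<and> labels s u}" using w(1) all(1) F(2) by (auto simp: leaves_def)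
      qed (use all(2) par_less in auto)
      then have "labels s v" using w by auto
      then show ?thesis using s v unfolding label_invariant_def by blast
    qed
    then show "copied n s \<and> (\<forall>v<n. \<exists>w \<in> leaves F. arr s ''leaf'' (int v) = int w \<and> v \<in> root_path F w)"
      using s by (simp add: label_invariant_def)
  qed
  ultimately have "halts_within (max_cost ?init + ((20 + max_cost label_step) * (2 * n + 1) - max_cost ?init))
     label_leaves s (\<lambda>s. copied n s \<and>
      (\<forall>v<n. \<exists>w \<in> leaves F. arr s ''leaf'' (int v) = int w \<and> v \<in> root_path F w))"
    unfolding label_leaves_def by (rule halts_within_Seq)
  then show ?thesis by (rule halts_within_mono) (simp_all add: algebra_simps)
qed

section \<open>Attaching the new vertices row by row\<close>

definition extended :: "store \<Rightarrow> bool" where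
  "extended s \<longleftrightarrow> (\<exists>leaf. (\<forall>i<m. leaf i \<in> leaves F \<and> low i \<in> root_path F (leaf i)) \<and>
      (\<forall>v<n + m. arr s ''parent1'' (int v) =
        int (tparent (graft F {n..<n + m} (\<lambda>x. leaf (x - n))) v)) \<and>
      (\<forall>v<n + m. arr s ''parent2'' (int v) = int (tparent (insert_rows F n low m) v)))"

lemma attach_loop:
  assumes cop: "copied n s"
    and leaf: "\<forall>v<n. \<exists>w \<in> leaves F. arr s ''leaf'' (int v) = int w \<and> v \<in> root_path F w"
  shows "halts_within ((20 + max_cost attach_row) * (m + 1)) (for_loop ''rows'' attach_row) s
    extended"
proof -
  obtain below where below: "\<And>v. v < n \<Longrightarrow> below v \<in> leaves F \<and>
      arr s ''leaf'' (int v) = int (below v) \<and> v \<in> root_path F (below v)"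
    using leaf by metis
  let ?T = "insert_rows F n low"
  define J where "J = (\<lambda>k s. var s ''i'' = int k \<and> input s \<and>
      (\<forall>v<n. arr s ''leaf'' (int v) = int (below v)) \<and>
      (\<forall>v<n. arr s ''parent1'' (int v) = int (par v)) \<and>
      (\<forall>i<k. arr s ''parent1'' (int (n + i)) = int (below (low i))) \<and>
      (\<forall>v<n + k. arr s ''parent2'' (int v) = int (tparent (?T k) v)))"
  have "halts_within ((20 + max_cost attach_row) * (m + 1)) (for_loop ''rows'' attach_row) s (J m)"
  proof (rule halts_within_for_loop)
    show "loop_free attach_row" by (simp add: attach_row_def)
    show "J 0 (s\<lparr>var := (var s)(''i'' := 0)\<rparr>)"
      using cop below by (simp add: J_def copied_def input_def)
    fix k s s' assume J: "J k s" and k: "k < m" and s': "s' = run attach_row s"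
    have l: "low k < n" using low k by blast
    have rt: "rooted_tree (?T k)" "tverts (?T k) = {..<n + k}"
      using insert_rows_invariants[OF F, of k low] low k by auto
    have v: "arr s ''colind'' (arr s ''rowptr'' (int k)) = int (low k)"
      and i: "var s ''i'' = int k" and c: "var s ''columns'' = int n"
      using J k by (simp_all add: J_def input_def)
    have p: "arr s ''parent2'' (int (low k)) = int (tparent (?T k) (low k))"
      using J l by (simp add: J_def)
    \<comment> \<open>This justifies detecting the root of the growing tree by comparing a vertex
      with its parent.\<close>
    have root: "tparent (?T k) (low k) = low k \<longleftrightarrow> low k = troot (?T k)"
      using parent_neq[OF rt(1)] rt(2) l by simp
    have p1: "arr s' ''parent1'' = (arr s ''parent1'')(int (n + k) := int (below (low k)))"
      using v i c J l by (simp add: s' attach_row_def J_def)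
    have p2: "arr s' ''parent2'' = (arr s ''parent2'')(int (n + k) :=
        int (if tparent (?T k) (low k) = low k then n + k else tparent (?T k) (low k)), int (low k) := int (n + k))"
      using v i c p l by (auto simp: s' attach_row_def)
    have keep: "var s' ''i'' = int k" "input s'" "arr s' ''leaf'' = arr s ''leaf''"
      using J by (simp_all add: J_def input_def s' attach_row_def)
    have "arr s' ''parent2'' (int u) = int (tparent (?T (Suc k)) u)" if "u < n + Suc k" for u
      using that J l by (auto simp: p2 J_def root)
    moreover have "arr s' ''parent1'' (int (n + i)) = int (below (low i))" if "i < Suc k" for i
      using that J by (auto simp: p1 J_def less_Suc_eq)
    moreover have "arr s' ''parent1'' (int u) = int (par u)" if "u < n" for u
      using that J by (auto simp: p1 J_def)
    ultimately show "J (Suc k) (s'\<lparr>var := (var s')(''i'' := var s' ''i'' + 1)\<rparr>)"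
      using J keep by (simp add: J_def input_def)
  qed (simp_all add: J_def input_def)
  then show ?thesis
  proof (rule halts_within_mono)
    fix s assume J: "J m s"
    have "arr s ''parent1'' (int v) = int (tparent (graft F {n..<n + m} (\<lambda>x. below (low (x - n)))) v)"
      if "v < n + m" for v
    proof (cases "v < n")
      case False
      then have "v = n + (v - n)" "v - n < m" using that by auto
      then show ?thesis using J unfolding J_def
        by (metis (no_types, lifting) add_diff_cancel_left' atLeastLessThan_iff graft_simps(3) that le_add1)
    qed (use J in \<open>simp add: J_def\<close>)
    then show "extended s"
      using J below low unfolding extended_def by (intro exI[of _ "\<lambda>i. below (low i)"]) (simp add: J_def)
  qed simp
qed

text \<open>The phases contribute \<open>n + 1\<close>, \<open>n + 1\<close>,
  \<open>2 * n + 1\<close> and \<open>m + 1\<close> units of \<open>step_cost\<close>;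
  \<open>5 * n\<close> leaves slack.\<close>

lemma extend_trees_correct:
  assumes "input s"
  shows "halts_within (step_cost * (5 * n + m + 4)) extend_trees s
    extended"
proof -
  let ?K = step_cost
  let ?t = "(20 + max_cost copy_row) * (n + 1) + ((20 + max_cost mark_inner) * (n + 1) +
    ((20 + max_cost label_step) * (2 * n + 1) + (20 + max_cost attach_row) * (m + 1)))"
  have "halts_within ?t extend_trees s
    extended"
    unfolding extend_trees_def
    by (rule halts_within_Seq[OF copy_loop[OF assms(1)]], elim conjE,
        rule halts_within_Seq[OF inner_loop], assumption, assumption, elim conjE,
        rule halts_within_Seq[OF label_loop], assumption, assumption, assumption, elim conjE,
        rule attach_loop)
  moreover have "?t \<le> ?K * (n + 1) + (?K * (n + 1) + (?K * (2 * n + 1) + ?K * (m + 1)))"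
    by (intro add_mono mult_mono) (simp_all add: step_cost_def)
  moreover have "\<dots> \<le> ?K * (5 * n + m + 4)" by (simp add: algebra_simps)
  ultimately show ?thesis by (blast intro: halts_within_mono le_trans)
qed

end

section \<open>Reading the lowest column of each row\<close>

text \<open>Rows are listed towards the root, so the first entry is the lowest column.\<close>

lemma stored_row_bottom:
  assumes "pure A" "stores_matrix s F A" and i: "i < dim_row A"
  shows "\<exists>j < dim_col A. arr s ''colind'' (arr s ''rowptr'' (int i)) = int j \<and>
    (\<forall>k < dim_col A. A $$ (i, k) \<noteq> 0 \<longrightarrow> k \<in> root_path F j)"
proof -
  obtain js where js: "set js = {j. j < dim_col A \<and> A $$ (i, j) \<noteq> 0}"
      "sorted_wrt (\<lambda>u v. v \<in> ancestors F u) js"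
    and col: "\<And>k. k < length js \<Longrightarrow>
      arr s ''colind'' (arr s ''rowptr'' (int i) + int k) = int (js ! k)"
    using assms(2) i unfolding stores_matrix_def upward_support_def by blast
  have "js \<noteq> []"
  proof
    assume "js = []"
    then have "A $$ (i, j) = 0" if "j < dim_col A" for j using js(1) that by auto
    \<comment> \<open>A zero row would be one row supported on no column, giving
      \<open>1 \<le> 0\<close>.\<close>
    then show False using card_rows_supported_le[OF assms(1), of "{}" "{i}"] i by auto
  qed
  then obtain j ks where jks: "js = j # ks" by (cases js) auto
  have "arr s ''colind'' (arr s ''rowptr'' (int i)) = int j" using col[of 0] jks by simp
  moreover have "j < dim_col A" using js(1) jks by auto
  moreover have "k \<in> root_path F j" if "k < dim_col A" "A $$ (i, k) \<noteq> 0" for k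
  proof -
    have "k \<in> set (j # ks)" using js(1) jks that by blast
    then show ?thesis using js(2) jks by (auto simp: ancestors_def)
  qed
  ultimately show ?thesis by blast
qed

lemma extend_trees_computes_decompositions:
  assumes "pure A" and td: "td_decomposition (primal_graph A) F"
    and s: "stores_matrix s F A" "stores_tree s ''parent'' (dim_col A) F"
  defines "N \<equiv> dim_col A + dim_row A"
  shows "\<exists>t s' F' F''.
    exec extend_trees s t s' \<and> t \<le> 10 * step_cost * card (tverts F) \<and>
    stores_tree s' ''parent1'' N F' \<and> stores_tree s' ''parent2'' N F'' \<and>
    rooted_tree F' \<and>
    subgraph (with_proj (primal_graph (with_identity A))) (with_proj (cl F')) \<and>
    height F' \<le> height F + 1 \<and> topological_height F' \<le> topological_height F + 1 \<and>
    rooted_tree F'' \<and>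
    subgraph (with_proj (primal_graph (with_identity A))) (with_proj (cl F'')) \<and>
    height F'' \<le> 2 * height F \<and> topological_height F'' = topological_height F"
proof -
  obtain low where bottom: "\<And>i. i < dim_row A \<Longrightarrow> low i < dim_col A"
    "\<And>i. i < dim_row A \<Longrightarrow> arr s ''colind'' (arr s ''rowptr'' (int i)) = int (low i)"
    "\<And>i j. i < dim_row A \<Longrightarrow> j < dim_col A \<Longrightarrow> A $$ (i, j) \<noteq> 0 \<Longrightarrow> j \<in> root_path F (low i)"
    using stored_row_bottom[OF assms(1) s(1)] by metis
  interpret row_bottoms A F low
    by unfold_locales (fact assms(1) td bottom)+
  interpret program_input "dim_col A" "dim_row A" F low
    by unfold_locales (fact tree tverts bottom)+
  have "input s"
    using s bottom(2) by (simp add: input_def stores_matrix_def stores_tree_def)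
  then obtain t s' where t: "exec extend_trees s t s'"
      "t \<le> step_cost * (5 * dim_col A + dim_row A + 4)" and "extended s'"
    using extend_trees_correct unfolding halts_within_def by blast
  then obtain leaf where leaf: "\<And>i. i < dim_row A \<Longrightarrow> leaf i \<in> leaves F \<and> low i \<in> root_path F (leaf i)"
    and p1: "\<forall>v<N. arr s' ''parent1'' (int v) =
      int (tparent (graft F {dim_col A..<N} (\<lambda>x. leaf (x - dim_col A))) v)"
    and p2: "\<forall>v<N. arr s' ''parent2'' (int v) = int (tparent (insert_rows F (dim_col A) low (dim_row A)) v)"
    unfolding extended_def N_def by blast
  \<comment> \<open>A rooted tree is nonempty, so there is at least one column; this absorbs the
    additive 4 into \<open>4 * dim_col A\<close>, and the number of rows is absorbed by another
    \<open>dim_col A\<close>.\<close>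
  have "troot F < dim_col A" using tree tverts by (auto simp: rooted_tree_def)
  then have "5 * dim_col A + dim_row A + 4 \<le> 10 * dim_col A" using dim_row_le_dim_col by linarith
  then have "t \<le> step_cost * (10 * dim_col A)" using t(2) mult_le_mono2 le_trans by blast
  then have "t \<le> 10 * step_cost * card (tverts F)" using tverts by (simp add: mult.assoc mult.left_commute)
  then show ?thesis
    using t(1) p1 p2 graft_rows[OF leaf] insert_rows_props unfolding stores_tree_def N_def
    by (intro exI[of _ t] exI[of _ s'] exI[of _ "graft F {dim_col A..<N} (\<lambda>x. leaf (x - dim_col A))"]
        exI[of _ "insert_rows F (dim_col A) low (dim_row A)"]) (simp only: N_def simp_thms)
qed

theorem lemma53:
  shows
    "(\<forall>m n A F_D.
        A \<in> carrier_mat m n \<longrightarrow>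
        Digraph_Component.connected (with_proj (primal_graph A)) \<longrightarrow>
        Digraph_Component.connected (with_proj (dual_graph A)) \<longrightarrow>
        td_decomposition (dual_graph A) F_D \<longrightarrow>
          dual_graph (with_identity A) = dual_graph A \<and>
          td_D (with_identity A) = td_D A \<and>
          subgraph (with_proj (dual_graph (with_identity A))) (with_proj (cl F_D))) \<and>
     (\<exists>prog (c :: nat). \<forall>P m n A F_P s.
        ip_instance P \<longrightarrow> ip_A P = A \<longrightarrow> A \<in> carrier_mat m n \<longrightarrow> pure A \<longrightarrow>
        Digraph_Component.connected (with_proj (primal_graph A)) \<longrightarrow>
        Digraph_Component.connected (with_proj (dual_graph A)) \<longrightarrow>
        td_decomposition (primal_graph A) F_P \<longrightarrow>
        stores_input s P F_P \<longrightarrow>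
          (\<exists>t s' F' F''.
             exec prog s t s' \<and> t \<le> c * card (tverts F_P) \<and>
             stores_tree s' ''parent1'' (n + m) F' \<and>
             stores_tree s' ''parent2'' (n + m) F'' \<and>
             rooted_tree F' \<and>
             subgraph (with_proj (primal_graph (with_identity A))) (with_proj (cl F')) \<and>
             height F' \<le> height F_P + 1 \<and>
             topological_height F' \<le> topological_height F_P + 1 \<and>
             rooted_tree F'' \<and>
             subgraph (with_proj (primal_graph (with_identity A))) (with_proj (cl F'')) \<and>
             height F'' \<le> 2 * height F_P \<and>
             topological_height F'' = topological_height F_P))"
proof (intro conjI allI impI)
  fix A :: "int mat" and F_D
  assume "td_decomposition (dual_graph A) F_D"
  then show "dual_graph (with_identity A) = dual_graph A" "td_D (with_identity A) = td_D A"
    "subgraph (with_proj (dual_graph (with_identity A))) (with_proj (cl F_D))"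
    by (simp_all add: dual_graph_with_identity td_D_def td_decomposition_def)
next
  show "\<exists>prog (c :: nat). \<forall>P m n A F_P s.
        ip_instance P \<longrightarrow> ip_A P = A \<longrightarrow> A \<in> carrier_mat m n \<longrightarrow> pure A \<longrightarrow>
        Digraph_Component.connected (with_proj (primal_graph A)) \<longrightarrow>
        Digraph_Component.connected (with_proj (dual_graph A)) \<longrightarrow>
        td_decomposition (primal_graph A) F_P \<longrightarrow>
        stores_input s P F_P \<longrightarrow>
          (\<exists>t s' F' F''.
             exec prog s t s' \<and> t \<le> c * card (tverts F_P) \<and>
             stores_tree s' ''parent1'' (n + m) F' \<and>
             stores_tree s' ''parent2'' (n + m) F'' \<and>
             rooted_tree F' \<and>
             subgraph (with_proj (primal_graph (with_identity A))) (with_proj (cl F')) \<and>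
             height F' \<le> height F_P + 1 \<and>
             topological_height F' \<le> topological_height F_P + 1 \<and>
             rooted_tree F'' \<and>
             subgraph (with_proj (primal_graph (with_identity A))) (with_proj (cl F'')) \<and>
             height F'' \<le> 2 * height F_P \<and>
             topological_height F'' = topological_height F_P)"
  proof (rule exI[of _ extend_trees], rule exI[of _ "10 * step_cost"], intro allI impI)
    fix P m n A F_P s
    assume "ip_A P = A" and dims: "A \<in> carrier_mat m n" and "pure A"
      and "td_decomposition (primal_graph A) F_P" and "stores_input s P F_P"
    then have "stores_matrix s F_P A" "stores_tree s ''parent'' (dim_col A) F_P"
      by (simp_all add: stores_input_def)
    note extend_trees_computes_decompositions[OF \<open>pure A\<close> \<open>td_decomposition _ _\<close> this]
    then show "\<exists>t s' F' F''.
             exec extend_trees s t s' \<and> t \<le> 10 * step_cost * card (tverts F_P) \<and>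
             stores_tree s' ''parent1'' (n + m) F' \<and>
             stores_tree s' ''parent2'' (n + m) F'' \<and>
             rooted_tree F' \<and>
             subgraph (with_proj (primal_graph (with_identity A))) (with_proj (cl F')) \<and>
             height F' \<le> height F_P + 1 \<and>
             topological_height F' \<le> topological_height F_P + 1 \<and>
             rooted_tree F'' \<and>
             subgraph (with_proj (primal_graph (with_identity A))) (with_proj (cl F'')) \<and>
             height F'' \<le> 2 * height F_P \<and>
             topological_height F'' = topological_height F_P"
      using dims by simp
  qed
qed

end
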